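(* Let $\mathcal H$ be a complex Hilbert space and let $P,Q$ be orthogonal projections on $\mathcal H$ such that $\dim \mathcal M_{01}=\dim\mathcal M_{10}$. Let $\mathcal H_g$ be the generic part of $\mathcal H$, and let $(\mathcal K,\mathbf M,a)$ be a canonical triple for $(P,Q)$, that is, a Hilbert space $\mathcal K$, a unitary operator $\mathbf M:\mathcal K\oplus\mathcal K\to\mathcal H_g$, and an injective positive operator $a$ on $\mathcal K$ with spectrum in $[0,1]$ and without the eigenvalue $1$, such that $$(P-Q)|_{\mathcal H_g}=\mathbf M\begin{bmatrix} a & 0 \\ 0 & -a\end{bmatrix}\mathbf M^*,\qquad (I-P-Q)|_{\mathcal H_g}=\mathbf M\begin{bmatrix} 0 & \sqrt{I-a^2} \\ \sqrt{I-a^2} & 0\end{bmatrix}\mathbf M^*.$$ Then the unitary operators $U$ on $\mathcal H$ satisfying $Q=UPU^*$ and $P=UQU^*$ are exactly the operators of the form $$U=U_0\oplus\begin{bmatrix} 0 & U_{10} \\ U_{01} & 0\end{bmatrix}\oplus U_1\oplus\mathbf M\begin{bmatrix} 0 & v \\ v & 0\end{bmatrix}\mathbf M^*$$ with respect to the orthogonal decomposition $\mathcal H=\mathcal M_{00}\oplus(\mathcal M_{10}\oplus\mathcal M_{01})\oplus\mathcal M_{11}\oplus\mathcal H_g$, where $U_0$ and $U_1$ are arbitrary unitary operators on $\mathcal M_{00}$ and $\mathcal M_{11}$, respectively, $U_{10}$ is an arbitrary unitary operator from $\mathcal M_{01}$ onto $\mathcal M_{10}$, $U_{01}$ is an arbitrary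 unitary operator from $\mathcal M_{10}$ onto $\mathcal M_{01}$, and $v$ is an arbitrary unitary operator on $\mathcal K$ commuting with $a$.
   Context: An orthogonal projection is a bounded operator $P$ with $P^2=P=P^*$. For orthogonal projections $P,Q$ on $\mathcal H$ put $\mathcal L=\operatorname{Ran}P$, $\mathcal N=\operatorname{Ran}Q$ and $\mathcal M_{00}=\mathcal L\cap\mathcal N$, $\mathcal M_{01}=\mathcal L\cap\mathcal N^\perp$, $\mathcal M_{10}=\mathcal N\cap\mathcal L^\perp$, $\mathcal M_{11}=\mathcal L^\perp\cap\mathcal N^\perp$. These four subspaces are mutually orthogonal and reduce both $P$ and $Q$. The generic part is $\mathcal H_g=\mathcal H\ominus(\mathcal M_{00}\oplus\mathcal M_{01}\oplus\mathcal M_{10}\oplus\mathcal M_{11})$; it is invariant under $P$ and $Q$. A triple $(\mathcal K,\mathbf M,a)$ with the properties listed in the claim always exists. Any of the summands may be $\{0\}$. *)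

theory Defs
  imports "HOL-Analysis.Analysis"
begin

section \<open>Complex Hilbert spaces\<close>

text \<open>
  The inner product is linear in the first argument. The class does not exclude the
  zero space.
\<close>

class complex_inner = real_normed_vector +
  fixes scaleC :: "complex \<Rightarrow> 'a \<Rightarrow> 'a" (infixr "*\<^sub>C" 75)
    and cinner :: "'a \<Rightarrow> 'a \<Rightarrow> complex"
  assumes scaleC_add_right: "c *\<^sub>C (x + y) = c *\<^sub>C x + c *\<^sub>C y"
    and scaleC_add_left: "(c + d) *\<^sub>C x = c *\<^sub>C x + d *\<^sub>C x"
    and scaleC_scaleC: "c *\<^sub>C d *\<^sub>C x = (c * d) *\<^sub>C x"
    and scaleR_scaleC: "r *\<^sub>R x = complex_of_real r *\<^sub>C x"
    and cinner_commute: "cinner x y = cnj (cinner y x)"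
    and cinner_add_left: "cinner (x + y) z = cinner x z + cinner y z"
    and cinner_scaleC_left: "cinner (c *\<^sub>C x) y = c * cinner x y"
    and cinner_self: "cinner x x = complex_of_real ((norm x)\<^sup>2)"

class chilbert_space = complex_inner + complete_space

global_interpretation complex_vector:
  vector_space "scaleC :: complex \<Rightarrow> 'a \<Rightarrow> 'a::complex_inner"
  defines cspan = complex_vector.span
proof
  fix c d :: complex and x y :: 'a
  show "c *\<^sub>C (x + y) = c *\<^sub>C x + c *\<^sub>C y"
    by (rule scaleC_add_right)
  show "(c + d) *\<^sub>C x = c *\<^sub>C x + d *\<^sub>C x"
    by (rule scaleC_add_left)
  show "c *\<^sub>C d *\<^sub>C x = (c * d) *\<^sub>C x"
    by (rule scaleC_scaleC)
  show "1 *\<^sub>C x = x"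
    using scaleR_scaleC[of 1 x] by simp
qed

instantiation complex :: chilbert_space
begin

definition scaleC_complex :: "complex \<Rightarrow> complex \<Rightarrow> complex"
  where "scaleC_complex c x = c * x"

definition cinner_complex :: "complex \<Rightarrow> complex \<Rightarrow> complex"
  where "cinner_complex x y = x * cnj y"

instance
proof
  fix c d x y z :: complex and r :: real
  show "c *\<^sub>C (x + y) = c *\<^sub>C x + c *\<^sub>C y"
    by (simp add: scaleC_complex_def distrib_left)
  show "(c + d) *\<^sub>C x = c *\<^sub>C x + d *\<^sub>C x"
    by (simp add: scaleC_complex_def distrib_right)
  show "c *\<^sub>C d *\<^sub>C x = (c * d) *\<^sub>C x"
    by (simp add: scaleC_complex_def)
  show "r *\<^sub>R x = complex_of_real r *\<^sub>C x"
    by (simp add: scaleC_complex_def scaleR_conv_of_real)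
  show "cinner x y = cnj (cinner y x)"
    by (simp add: cinner_complex_def)
  show "cinner (x + y) z = cinner x z + cinner y z"
    by (simp add: cinner_complex_def distrib_right)
  show "cinner (c *\<^sub>C x) y = c * cinner x y"
    by (simp add: cinner_complex_def scaleC_complex_def)
  show "cinner x x = complex_of_real ((norm x)\<^sup>2)"
    unfolding cinner_complex_def by (rule complex_norm_square[symmetric])
qed

end

text \<open>
  The Hilbert space direct sum \<open>\<K> \<oplus> \<K>\<close> is the product type; the norm of the
  library's product instance is the one induced by this inner product.
\<close>

instantiation prod :: (complex_inner, complex_inner) complex_inner
begin

definition scaleC_prod :: "complex \<Rightarrow> 'a \<times> 'b \<Rightarrow> 'a \<times> 'b"
  where "scaleC_prod c x = (c *\<^sub>C fst x, c *\<^sub>C snd x)"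

definition cinner_prod :: "'a \<times> 'b \<Rightarrow> 'a \<times> 'b \<Rightarrow> complex"
  where "cinner_prod x y = cinner (fst x) (fst y) + cinner (snd x) (snd y)"

instance
proof
  fix c d :: complex and r :: real and x y z :: "'a \<times> 'b"
  show "c *\<^sub>C (x + y) = c *\<^sub>C x + c *\<^sub>C y"
    by (simp add: scaleC_prod_def scaleC_add_right)
  show "(c + d) *\<^sub>C x = c *\<^sub>C x + d *\<^sub>C x"
    by (simp add: scaleC_prod_def scaleC_add_left)
  show "c *\<^sub>C d *\<^sub>C x = (c * d) *\<^sub>C x"
    by (simp add: scaleC_prod_def scaleC_scaleC)
  show "r *\<^sub>R x = complex_of_real r *\<^sub>C x"
    by (simp add: scaleC_prod_def scaleR_prod_def scaleR_scaleC)
  show "cinner x y = cnj (cinner y x)"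
    by (simp add: cinner_prod_def cinner_commute[of "fst x" "fst y"]
        cinner_commute[of "snd x" "snd y"])
  show "cinner (x + y) z = cinner x z + cinner y z"
    by (simp add: cinner_prod_def cinner_add_left)
  show "cinner (c *\<^sub>C x) y = c * cinner x y"
    by (simp add: cinner_prod_def scaleC_prod_def cinner_scaleC_left distrib_left)
  show "cinner x x = complex_of_real ((norm x)\<^sup>2)"
    by (simp add: cinner_prod_def cinner_self norm_prod_def)
qed

end

instance prod :: (chilbert_space, chilbert_space) chilbert_space ..

section \<open>Subspaces and Hilbert dimension\<close>

definition orth_compl :: "'a::complex_inner set \<Rightarrow> 'a set"
  where "orth_compl S = {x. \<forall>y\<in>S. cinner x y = 0}"

text \<open>Meaningful for closed subspaces \<open>S\<close> of a Hilbert space.\<close>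

definition orth_proj :: "'a::complex_inner set \<Rightarrow> 'a \<Rightarrow> 'a"
  where "orth_proj S x = (THE y. y \<in> S \<and> x - y \<in> orth_compl S)"

definition orthonormal_basis :: "'a::complex_inner set \<Rightarrow> 'a set \<Rightarrow> bool"
  where "orthonormal_basis B S \<longleftrightarrow>
    B \<subseteq> S \<and> (\<forall>x\<in>B. norm x = 1) \<and> (\<forall>x\<in>B. \<forall>y\<in>B. x \<noteq> y \<longrightarrow> cinner x y = 0) \<and>
    S \<subseteq> closure (cspan B)"

text \<open>
  The dimension of a closed subspace as a cardinal, in the library's representation of
  cardinals by well-orders. Equality of two such cardinals is the relation \<open>ordIso\<close>,
  not \<open>=\<close>.
\<close>

definition hilbert_dim :: "'a::complex_inner set \<Rightarrow> 'a rel"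
  where "hilbert_dim S = card_of (SOME B. orthonormal_basis B S)"

section \<open>Operators\<close>

definition bounded_clinear :: "('a::complex_inner \<Rightarrow> 'b::complex_inner) \<Rightarrow> bool"
  where "bounded_clinear T \<longleftrightarrow> bounded_linear T \<and> (\<forall>c x. T (c *\<^sub>C x) = c *\<^sub>C T x)"

definition cadjoint :: "('a::complex_inner \<Rightarrow> 'b::complex_inner) \<Rightarrow> 'b \<Rightarrow> 'a"
  where "cadjoint T = (THE S. \<forall>x y. cinner (T x) y = cinner x (S y))"

definition orthogonal_projection :: "('a::complex_inner \<Rightarrow> 'a) \<Rightarrow> bool"
  where "orthogonal_projection P \<longleftrightarrow> bounded_clinear P \<and> P \<circ> P = P \<and> cadjoint P = P"

text \<open>
  Unitary operators from a subspace \<open>S\<close> onto a subspace \<open>T\<close>. The values of \<open>U\<close>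
  outside \<open>S\<close> are irrelevant.
\<close>

definition unitary_onto ::
    "'a::complex_inner set \<Rightarrow> 'b::complex_inner set \<Rightarrow> ('a \<Rightarrow> 'b) \<Rightarrow> bool"
  where "unitary_onto S T U \<longleftrightarrow>
    (\<forall>x\<in>S. \<forall>y\<in>S. U (x + y) = U x + U y) \<and>
    (\<forall>c. \<forall>x\<in>S. U (c *\<^sub>C x) = c *\<^sub>C U x) \<and>
    (\<forall>x\<in>S. \<forall>y\<in>S. cinner (U x) (U y) = cinner x y) \<and>
    U ` S = T"

abbreviation unitary :: "('a::complex_inner \<Rightarrow> 'a) \<Rightarrow> bool"
  where "unitary \<equiv> unitary_onto UNIV UNIV"

text \<open>On a complex Hilbert space this condition implies self-adjointness.\<close>

definition positive_operator :: "('a::complex_inner \<Rightarrow> 'a) \<Rightarrow> bool"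
  where "positive_operator T \<longleftrightarrow> bounded_clinear T \<and> (\<forall>x. cinner (T x) x \<in> \<real>\<^sub>\<ge>\<^sub>0)"

definition operator_sqrt :: "('a::complex_inner \<Rightarrow> 'a) \<Rightarrow> 'a \<Rightarrow> 'a"
  where "operator_sqrt T = (THE S. positive_operator S \<and> S \<circ> S = T)"

definition spectrum :: "('a::complex_inner \<Rightarrow> 'a) \<Rightarrow> complex set"
  where "spectrum T = {l. \<not> (\<exists>S. bounded_clinear S \<and>
    S \<circ> (\<lambda>x. T x - l *\<^sub>C x) = id \<and> (\<lambda>x. T x - l *\<^sub>C x) \<circ> S = id)}"

definition eigenvalue :: "('a::complex_inner \<Rightarrow> 'a) \<Rightarrow> complex \<Rightarrow> bool"
  where "eigenvalue T l \<longleftrightarrow> (\<exists>x. x \<noteq> 0 \<and> T x = l *\<^sub>C x)"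

text \<open>The block matrix with rows \<open>(A, B)\<close> and \<open>(C, D)\<close>.\<close>

definition block_operator ::
    "('a \<Rightarrow> 'a) \<Rightarrow> ('a \<Rightarrow> 'a) \<Rightarrow> ('a \<Rightarrow> 'a) \<Rightarrow> ('a \<Rightarrow> 'a) \<Rightarrow> 'a \<times> 'a \<Rightarrow> 'a::complex_inner \<times> 'a"
  where "block_operator A B C D = (\<lambda>(x, y). (A x + B y, C x + D y))"

section \<open>Pairs of orthogonal projections\<close>

definition M00 :: "('a::complex_inner \<Rightarrow> 'a) \<Rightarrow> ('a \<Rightarrow> 'a) \<Rightarrow> 'a set"
  where "M00 P Q = range P \<inter> range Q"

definition M01 :: "('a::complex_inner \<Rightarrow> 'a) \<Rightarrow> ('a \<Rightarrow> 'a) \<Rightarrow> 'a set"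
  where "M01 P Q = range P \<inter> orth_compl (range Q)"

definition M10 :: "('a::complex_inner \<Rightarrow> 'a) \<Rightarrow> ('a \<Rightarrow> 'a) \<Rightarrow> 'a set"
  where "M10 P Q = range Q \<inter> orth_compl (range P)"

definition M11 :: "('a::complex_inner \<Rightarrow> 'a) \<Rightarrow> ('a \<Rightarrow> 'a) \<Rightarrow> 'a set"
  where "M11 P Q = orth_compl (range P) \<inter> orth_compl (range Q)"

text \<open>
  The sum below is the elementwise sum of sets; as the four summands are mutually
  orthogonal closed subspaces, it is their orthogonal direct sum.
\<close>

definition generic_part :: "('a::complex_inner \<Rightarrow> 'a) \<Rightarrow> ('a \<Rightarrow> 'a) \<Rightarrow> 'a set"
  where "generic_part P Q = orth_compl (M00 P Q + M01 P Q + M10 P Q + M11 P Q)"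

text \<open>
  The space \<open>\<K>\<close> of the triple is the type \<open>'k\<close>. The operator \<open>M\<close> is typed as a map into
  the whole space; the restriction of its adjoint to the generic part is the adjoint of
  \<open>M\<close> as an operator onto the generic part.
\<close>

definition canonical_triple ::
    "('h::chilbert_space \<Rightarrow> 'h) \<Rightarrow> ('h \<Rightarrow> 'h) \<Rightarrow>
     ('k::chilbert_space \<times> 'k \<Rightarrow> 'h) \<Rightarrow> ('k \<Rightarrow> 'k) \<Rightarrow> bool"
  where "canonical_triple P Q M a \<longleftrightarrow>
    unitary_onto UNIV (generic_part P Q) M \<and>
    positive_operator a \<and> inj a \<and>
    spectrum a \<subseteq> complex_of_real ` {0..1} \<and> \<not> eigenvalue a 1 \<and>
    (\<forall>x\<in>generic_part P Q. P x - Q x =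
       M (block_operator a (\<lambda>_. 0) (\<lambda>_. 0) (\<lambda>y. - a y) (cadjoint M x))) \<and>
    (\<forall>x\<in>generic_part P Q. x - P x - Q x =
       M (block_operator (\<lambda>_. 0) (operator_sqrt (\<lambda>y. y - a (a y)))
                         (operator_sqrt (\<lambda>y. y - a (a y))) (\<lambda>_. 0) (cadjoint M x)))"

text \<open>
  \<open>U\<^sub>0 \<oplus> [[0, U\<^sub>1\<^sub>0], [U\<^sub>0\<^sub>1, 0]] \<oplus> U\<^sub>1 \<oplus> M [[0, v], [v, 0]] M\<^sup>*\<close> with respect to the decomposition
  \<open>M00 \<oplus> (M10 \<oplus> M01) \<oplus> M11 \<oplus> generic_part\<close>; the second block sends \<open>(x, y)\<close> with \<open>x\<close> in \<open>M10\<close>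
  and \<open>y\<close> in \<open>M01\<close> to \<open>(U\<^sub>1\<^sub>0 y, U\<^sub>0\<^sub>1 x)\<close>.
\<close>

definition swap_form ::
    "('h::chilbert_space \<Rightarrow> 'h) \<Rightarrow> ('h \<Rightarrow> 'h) \<Rightarrow> ('k::chilbert_space \<times> 'k \<Rightarrow> 'h) \<Rightarrow>
     ('h \<Rightarrow> 'h) \<Rightarrow> ('h \<Rightarrow> 'h) \<Rightarrow> ('h \<Rightarrow> 'h) \<Rightarrow> ('h \<Rightarrow> 'h) \<Rightarrow> ('k \<Rightarrow> 'k) \<Rightarrow> 'h \<Rightarrow> 'h"
  where "swap_form P Q M U0 U10 U01 U1 v x =
    U0 (orth_proj (M00 P Q) x) +
    (U10 (orth_proj (M01 P Q) x) + U01 (orth_proj (M10 P Q) x)) +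
    U1 (orth_proj (M11 P Q) x) +
    M (block_operator (\<lambda>_. 0) v v (\<lambda>_. 0) (cadjoint M (orth_proj (generic_part P Q) x)))"

end

theory Submission imports Defs begin

text \<open>
  Put \<open>A = P - Q\<close> and \<open>B = I - P - Q\<close>. A unitary \<open>U\<close> exchanges \<open>P\<close> and \<open>Q\<close> iff it anticommutes
  with \<open>A\<close> and commutes with \<open>B\<close>. Such a \<open>U\<close> preserves \<open>M00\<close>, \<open>M11\<close> and the generic part and
  exchanges \<open>M01\<close> with \<open>M10\<close>. On the generic part, write \<open>M\<^sup>* U M\<close> as a \<open>2 \<times> 2\<close> block matrix. Its
  diagonal entries anticommute with \<open>a\<close>, so they commute with \<open>a\<^sup>2\<close>, hence with its positive root
  \<open>a\<close>, and vanish because \<open>a\<close> is injective. The off-diagonal entries commute with \<open>a\<close>, hence with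
  \<open>s = sqrt (I - a\<^sup>2)\<close>; commutation with \<open>B\<close> then says that \<open>s\<close> annihilates their difference, and
  \<open>s\<close> is injective since 1 is not an eigenvalue of \<open>a\<close>. The bound \<open>norm (a x) \<le> norm x\<close>, needed to
  construct the roots, follows from \<open>A\<^sup>2 + B\<^sup>2 = I\<close>.
\<close>

section \<open>Inner products\<close>

lemma cinner_add_right: "cinner x (y + z) = cinner x y + cinner x z"
  by (metis cinner_add_left cinner_commute complex_cnj_add)

lemma cinner_scaleC_right: "cinner x (c *\<^sub>C y) = cnj c * cinner x y"
  by (metis cinner_commute cinner_scaleC_left complex_cnj_mult)

lemma cinner_zero_left [simp]: "cinner 0 x = 0"
  using cinner_add_left[of 0 0 x] by simp

lemma cinner_zero_right [simp]: "cinner x 0 = 0"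
  using cinner_add_right[of x 0 0] by simp

lemma cinner_minus_left: "cinner (- x) y = - cinner x y"
  using cinner_add_left[of x "- x" y] by (simp add: add_eq_0_iff)

lemma cinner_minus_right: "cinner x (- y) = - cinner x y"
  using cinner_add_right[of x y "- y"] by (simp add: add_eq_0_iff)

lemma cinner_diff_left: "cinner (x - y) z = cinner x z - cinner y z"
  using cinner_add_left[of x "- y" z] by (simp add: cinner_minus_left)

lemma cinner_diff_right: "cinner x (y - z) = cinner x y - cinner x z"
  using cinner_add_right[of x y "- z"] by (simp add: cinner_minus_right)

lemma cinner_scaleR_left: "cinner (r *\<^sub>R x) y = complex_of_real r * cinner x y"
  by (simp add: scaleR_scaleC cinner_scaleC_left)

lemma cinner_scaleR_right: "cinner x (r *\<^sub>R y) = complex_of_real r * cinner x y"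
  by (simp add: scaleR_scaleC cinner_scaleC_right)

lemmas cinner_simps = cinner_add_left cinner_add_right cinner_diff_left cinner_diff_right
  cinner_minus_left cinner_minus_right cinner_scaleC_left cinner_scaleC_right
  cinner_scaleR_left cinner_scaleR_right

lemma cinner_eq_zero_iff [simp]: "cinner x x = 0 \<longleftrightarrow> x = 0"
  by (simp add: cinner_self)

lemma cinner_eqI: "x = y" if "\<And>z. cinner z x = cinner z y"
proof -
  have "cinner (x - y) (x - y) = 0"
    by (simp add: that cinner_diff_right del: cinner_eq_zero_iff)
  then show ?thesis by simp
qed

lemma cinner_zero_commute: "cinner x y = 0 \<longleftrightarrow> cinner y x = 0"
  by (metis cinner_commute complex_cnj_zero)

lemma norm_add_power2: "(norm (x + y))\<^sup>2 = (norm x)\<^sup>2 + (norm y)\<^sup>2 + 2 * Re (cinner x y)"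
proof -
  have "complex_of_real ((norm (x + y))\<^sup>2) =
      cinner x x + cinner y y + (cinner x y + cnj (cinner x y))"
    unfolding cinner_self[symmetric]
    by (simp add: cinner_simps cinner_commute[of y x])
  also have "\<dots> = complex_of_real ((norm x)\<^sup>2 + (norm y)\<^sup>2 + 2 * Re (cinner x y))"
    by (simp add: cinner_self complex_add_cnj)
  finally show ?thesis
    using of_real_eq_iff by blast
qed

lemma norm_diff_power2: "(norm (x - y))\<^sup>2 = (norm x)\<^sup>2 + (norm y)\<^sup>2 - 2 * Re (cinner x y)"
  using norm_add_power2[of x "- y"] by (simp add: cinner_minus_right)

lemma norm_scaleC: "norm (c *\<^sub>C x) = cmod c * norm x"
proof -
  have "cinner (c *\<^sub>C x) (c *\<^sub>C x) = c * cnj c * cinner x x"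
    by (simp add: cinner_simps)
  then have "complex_of_real ((norm (c *\<^sub>C x))\<^sup>2) = complex_of_real ((cmod c * norm x)\<^sup>2)"
    by (simp only: cinner_self complex_norm_square[symmetric] power_mult_distrib of_real_mult)
  then have "(norm (c *\<^sub>C x))\<^sup>2 = (cmod c * norm x)\<^sup>2"
    using of_real_eq_iff by blast
  then show ?thesis
    by (simp add: power2_eq_iff_nonneg)
qed

text \<open>Pythagoras for the residual of \<open>x\<close> after projection onto the line of
  \<open>y\<close>. Its nonnegativity yields the Cauchy-Schwarz inequality, and the decrease in norm
  proves orthogonality at a nearest point.\<close>

lemma norm_power2_diff_projection:
  assumes "y \<noteq> 0"
  shows "(norm (x - (cinner x y / complex_of_real ((norm y)\<^sup>2)) *\<^sub>C y))\<^sup>2 =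
    (norm x)\<^sup>2 - (cmod (cinner x y))\<^sup>2 / (norm y)\<^sup>2"
proof -
  define n where "n = (norm y)\<^sup>2"
  have n: "n \<noteq> 0" using assms by (simp add: n_def)
  have "Re (cinner x ((cinner x y / complex_of_real n) *\<^sub>C y)) = (cmod (cinner x y))\<^sup>2 / n"
    by (simp add: cinner_scaleC_right complex_norm_square[symmetric] mult.commute
        flip: of_real_power)
  moreover have "(norm ((cinner x y / complex_of_real n) *\<^sub>C y))\<^sup>2 = (cmod (cinner x y))\<^sup>2 / n"
    using n by (simp add: norm_scaleC norm_divide power_mult_distrib power_divide
        flip: n_def) (simp add: power2_eq_square)
  ultimately show ?thesis
    unfolding norm_diff_power2 n_def[symmetric] by simp
qed

section \<open>The Cauchy-Schwarz inequality and continuity of the inner product\<close>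

lemma norm_cinner_le: "cmod (cinner x y) \<le> norm x * norm y"
proof (cases "y = 0")
  case False
  have "0 \<le> (norm x)\<^sup>2 - (cmod (cinner x y))\<^sup>2 / (norm y)\<^sup>2"
    using norm_power2_diff_projection[OF False, of x] by (metis zero_le_power2)
  then have "(cmod (cinner x y))\<^sup>2 \<le> (norm x * norm y)\<^sup>2"
    using False by (simp add: field_simps power_mult_distrib)
  then show ?thesis
    by (rule power2_le_imp_le) simp
qed simp

lemma bounded_linear_cinner_left: "bounded_linear (\<lambda>x. cinner x y)"
  by (rule bounded_linear_intro[where K = "norm y"])
    (simp_all add: cinner_simps norm_cinner_le scaleR_conv_of_real)

lemma bounded_linear_cinner_right: "bounded_linear (cinner x)"
  by (rule bounded_linear_intro[where K = "norm x"])
    (simp_all add: cinner_simps scaleR_conv_of_real, metis norm_cinner_le mult.commute)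

lemmas tendsto_cinner_left = bounded_linear.tendsto[OF bounded_linear_cinner_left]
lemmas tendsto_cinner_right = bounded_linear.tendsto[OF bounded_linear_cinner_right]

section \<open>Orthogonal projections onto closed subspaces\<close>

lemma orth_complD: "x \<in> orth_compl S \<Longrightarrow> y \<in> S \<Longrightarrow> cinner x y = 0"
  by (simp add: orth_compl_def)

lemma subspace_orth_compl: "complex_vector.subspace (orth_compl S)"
  by (auto simp: complex_vector.subspace_def orth_compl_def cinner_simps)

text \<open>A sequence minimising the distance to \<open>S\<close> is Cauchy by the parallelogram
  law; completeness and closedness give a nearest point, and the residual there is orthogonal to
  \<open>S\<close>.\<close>

lemma orthogonal_decomposition_exists:
  fixes S :: "'a::chilbert_space set"
  assumes sub: "complex_vector.subspace S" and cl: "closed S"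
  shows "\<exists>y\<in>S. x - y \<in> orth_compl S"
proof -
  define d where "d = infdist x S"
  have ne: "S \<noteq> {}"
    using complex_vector.subspace_0[OF sub] by auto
  have d0: "0 \<le> d" by (simp add: d_def infdist_nonneg)
  have dle: "d \<le> norm (x - y)" if "y \<in> S" for y
    using infdist_le[OF that, of x] by (simp add: d_def dist_norm)
  have "\<exists>y\<in>S. norm (x - y) < d + 1 / Suc n" for n
  proof (rule ccontr)
    assume "\<not> ?thesis"
    then have "d + 1 / Suc n \<le> infdist x S"
      using ne by (auto simp: infdist_def dist_norm not_less intro!: cINF_greatest)
    then show False by (simp add: d_def)
  qed
  then obtain f where fS: "\<And>n. f n \<in> S" and fd: "\<And>n. norm (x - f n) < d + 1 / Suc n"
    by metis
  have lim_d: "(\<lambda>n. norm (x - f n)) \<longlonglongrightarrow> d"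
  proof (rule tendsto_sandwich)
    show "(\<lambda>n. d) \<longlonglongrightarrow> d" by simp
    show "(\<lambda>n. d + 1 / real (Suc n)) \<longlonglongrightarrow> d"
      using tendsto_add[OF tendsto_const LIMSEQ_inverse_real_of_nat, of d]
      by (simp add: inverse_eq_divide)
  qed (use fS less_imp_le[OF fd] dle in \<open>auto intro!: always_eventually simp del: of_nat_Suc\<close>)
  \<comment> \<open>Parallelogram law for \<open>x - f m\<close> and \<open>x - f n\<close>: half
    their sum is \<open>x\<close> minus a midpoint that lies in \<open>S\<close>, so its norm is at
    least \<open>d\<close>.\<close>
  have par: "(norm (f m - f n))\<^sup>2 \<le> 2 * (norm (x - f m))\<^sup>2 + 2 * (norm (x - f n))\<^sup>2 - 4 * d\<^sup>2"
    for m n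
  proof -
    have "(1/2) *\<^sub>R (f m + f n) \<in> S"
      unfolding scaleR_scaleC
      by (intro complex_vector.subspace_scale[OF sub] complex_vector.subspace_add[OF sub] fS)
    then have "d \<le> norm (x - (1/2) *\<^sub>R (f m + f n))" by (rule dle)
    then have "d\<^sup>2 \<le> (norm (x - (1/2) *\<^sub>R (f m + f n)))\<^sup>2"
      using d0 by (intro power_mono)
    moreover have "(x - f m) + (x - f n) = 2 *\<^sub>R (x - (1/2) *\<^sub>R (f m + f n))"
      by (simp add: algebra_simps scaleR_2)
    then have "(norm ((x - f m) + (x - f n)))\<^sup>2 = 4 * (norm (x - (1/2) *\<^sub>R (f m + f n)))\<^sup>2"
      by (simp add: power_mult_distrib)
    moreover have "(norm ((x - f m) + (x - f n)))\<^sup>2 + (norm ((x - f n) - (x - f m)))\<^sup>2 =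
        2 * (norm (x - f m))\<^sup>2 + 2 * (norm (x - f n))\<^sup>2"
      unfolding norm_add_power2 norm_diff_power2
      by (simp add: cinner_commute[of "x - f n" "x - f m"])
    ultimately show ?thesis by simp
  qed
  have "Cauchy f"
  proof (rule metric_CauchyI)
    fix e :: real assume "0 < e"
    have "(\<lambda>n. (norm (x - f n))\<^sup>2) \<longlonglongrightarrow> d\<^sup>2"
      using lim_d by (rule tendsto_power)
    then have "eventually (\<lambda>n. (norm (x - f n))\<^sup>2 < d\<^sup>2 + e\<^sup>2 / 4) sequentially"
      using \<open>0 < e\<close> by (intro order_tendstoD) auto
    \<comment> \<open>The tolerance \<open>e\<^sup>2 / 4\<close> is counted four times in
      \<open>par\<close>, where \<open>4 * d\<^sup>2\<close> cancels and \<open>e\<^sup>2\<close>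
      remains.\<close>
    then obtain N where N: "\<And>n. N \<le> n \<Longrightarrow> (norm (x - f n))\<^sup>2 < d\<^sup>2 + e\<^sup>2 / 4"
      by (auto simp: eventually_sequentially)
    have "dist (f m) (f n) < e" if "N \<le> m" "N \<le> n" for m n
    proof -
      have "(norm (f m - f n))\<^sup>2 < e\<^sup>2"
        using par[of m n] N[OF that(1)] N[OF that(2)] by linarith
      then show ?thesis
        using \<open>0 < e\<close> by (simp add: dist_norm power_less_imp_less_base)
    qed
    then show "\<exists>N. \<forall>m\<ge>N. \<forall>n\<ge>N. dist (f m) (f n) < e" by blast
  qed
  then obtain y where y: "f \<longlonglongrightarrow> y"
    using Cauchy_convergent convergent_def by blast
  have yS: "y \<in> S"
    using closed_sequentially[OF cl _ y] fS by blast
  have "(\<lambda>n. norm (x - f n)) \<longlonglongrightarrow> norm (x - y)"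
    by (intro tendsto_intros y)
  then have yd: "norm (x - y) = d"
    using lim_d LIMSEQ_unique by blast
  have "cinner (x - y) z = 0" if z: "z \<in> S" for z
  proof (rule ccontr)
    assume ne0: "cinner (x - y) z \<noteq> 0"
    then have z0: "z \<noteq> 0" by auto
    \<comment> \<open>Moving \<open>y\<close> by \<open>c *\<^sub>C z\<close> inside
      \<open>S\<close> removes the component of the residual along \<open>z\<close>; a nonzero
      component would give a point closer to \<open>x\<close> than \<open>y\<close>.\<close>
    define c where "c = cinner (x - y) z / complex_of_real ((norm z)\<^sup>2)"
    have "y + c *\<^sub>C z \<in> S"
      by (intro complex_vector.subspace_scale[OF sub] complex_vector.subspace_add[OF sub] yS z)
    from dle[OF this] have "d \<le> norm ((x - y) - c *\<^sub>C z)"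
      by (simp add: algebra_simps)
    then have "(norm (x - y))\<^sup>2 \<le> (norm ((x - y) - c *\<^sub>C z))\<^sup>2"
      unfolding yd using d0 by (intro power_mono)
    also have "\<dots> = (norm (x - y))\<^sup>2 - (cmod (cinner (x - y) z))\<^sup>2 / (norm z)\<^sup>2"
      unfolding c_def by (rule norm_power2_diff_projection[OF z0])
    finally show False
      using ne0 z0 by (simp add: field_simps)
  qed
  then show ?thesis
    using yS by (auto simp: orth_compl_def)
qed

lemma orth_proj_eqI:
  assumes sub: "complex_vector.subspace S" and y: "y \<in> S" "x - y \<in> orth_compl S"
  shows "orth_proj S x = y"
  unfolding orth_proj_def
proof (rule the_equality)
  fix z assume z: "z \<in> S \<and> x - z \<in> orth_compl S"
  have "(x - z) - (x - y) \<in> orth_compl S"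
    using z y complex_vector.subspace_diff[OF subspace_orth_compl] by blast
  moreover have "y - z \<in> S"
    using z y complex_vector.subspace_diff[OF sub] by blast
  ultimately have "cinner (y - z) (y - z) = 0"
    by (auto dest: orth_complD)
  then show "z = y" by simp
qed (use y in simp)

lemma
  fixes S :: "'a::chilbert_space set"
  assumes "complex_vector.subspace S" and "closed S"
  shows orth_proj_in: "orth_proj S x \<in> S"
    and diff_orth_proj_in: "x - orth_proj S x \<in> orth_compl S"
  using orthogonal_decomposition_exists[OF assms, of x] orth_proj_eqI[OF assms(1)] by metis+

section \<open>Adjoints\<close>

lemma bounded_clinear_add: "bounded_clinear T \<Longrightarrow> T (x + y) = T x + T y"
  and bounded_clinear_diff: "bounded_clinear T \<Longrightarrow> T (x - y) = T x - T y"
  and bounded_clinear_minus: "bounded_clinear T \<Longrightarrow> T (- x) = - T x"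
  and bounded_clinear_zero: "bounded_clinear T \<Longrightarrow> T 0 = 0"
  and bounded_clinear_scaleR: "bounded_clinear T \<Longrightarrow> T (r *\<^sub>R x) = r *\<^sub>R T x"
  and bounded_clinear_scaleC: "bounded_clinear T \<Longrightarrow> T (c *\<^sub>C x) = c *\<^sub>C T x"
  by (auto simp: bounded_clinear_def linear_add linear_diff linear_neg linear_0 linear_scale
      bounded_linear.linear)

lemmas bounded_clinear_simps = bounded_clinear_add bounded_clinear_diff bounded_clinear_minus
  bounded_clinear_zero bounded_clinear_scaleR bounded_clinear_scaleC

lemma bounded_clinearI:
  assumes "\<And>x y. T (x + y) = T x + T y" and "\<And>c x. T (c *\<^sub>C x) = c *\<^sub>C T x"
    and "\<And>x. norm (T x) \<le> norm x * K"
  shows "bounded_clinear T"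
  unfolding bounded_clinear_def
  using assms by (auto intro!: bounded_linear_intro[where K = K] simp: scaleR_scaleC)

lemma bounded_clinear_compose:
  "bounded_clinear S \<Longrightarrow> bounded_clinear T \<Longrightarrow> bounded_clinear (\<lambda>x. S (T x))"
  by (auto simp: bounded_clinear_def intro: bounded_linear_compose)

lemma bounded_clinear_sub:
  "bounded_clinear S \<Longrightarrow> bounded_clinear T \<Longrightarrow> bounded_clinear (\<lambda>x. S x - T x)"
  by (auto simp: bounded_clinear_def complex_vector.scale_right_diff_distrib
      intro: bounded_linear_sub)

lemma bounded_clinear_id: "bounded_clinear (\<lambda>x. x)"
  by (simp add: bounded_clinear_def)

text \<open>The kernel of \<open>f\<close> is closed, and a vector \<open>u\<close> orthogonal to it
  accounts for the rest: subtracting a suitable multiple of \<open>u\<close> puts any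
  \<open>x\<close> into the kernel.\<close>

lemma riesz_representation:
  fixes f :: "'a::chilbert_space \<Rightarrow> complex"
  assumes f: "bounded_clinear f"
  shows "\<exists>w. \<forall>x. f x = cinner x w"
proof (cases "\<forall>x. f x = 0")
  case False
  then obtain x0 where x0: "f x0 \<noteq> 0" by blast
  define N where "N = {x. f x = 0}"
  have sub: "complex_vector.subspace N"
    by (auto simp: N_def complex_vector.subspace_def bounded_clinear_simps[OF f] scaleC_complex_def)
  have cl: "closed N"
    unfolding N_def using f
    by (intro closed_Collect_eq continuous_intros linear_continuous_on)
      (simp add: bounded_clinear_def)
  define u where "u = x0 - orth_proj N x0"
  have u: "u \<in> orth_compl N"
    unfolding u_def by (rule diff_orth_proj_in[OF sub cl])
  have fu: "f u = f x0"
    using orth_proj_in[OF sub cl, of x0] by (simp add: u_def bounded_clinear_simps[OF f] N_def)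
  then have u0: "u \<noteq> 0"
    using x0 bounded_clinear_zero[OF f] by auto
  \<comment> \<open>The scalar is fixed by testing at \<open>u\<close>; it is conjugated because
    \<open>cinner\<close> is conjugate linear in its second argument.\<close>
  have "f x = cinner x ((cnj (f u) / complex_of_real ((norm u)\<^sup>2)) *\<^sub>C u)" for x
  proof -
    have "x - (f x / f u) *\<^sub>C u \<in> N"
      using fu x0 by (simp add: N_def bounded_clinear_simps[OF f] scaleC_complex_def)
    then have "cinner (x - (f x / f u) *\<^sub>C u) u = 0"
      using u orth_complD cinner_zero_commute by blast
    then have "cinner x u = f x / f u * complex_of_real ((norm u)\<^sup>2)"
      by (simp add: cinner_simps cinner_self)
    then show ?thesis
      using fu x0 u0 by (simp add: cinner_simps)
  qed
  then show ?thesis by blast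
next
  case True
  then have "\<forall>x. f x = cinner x 0" by simp
  then show ?thesis ..
qed

lemma cadjoint_eqI:
  assumes "\<And>x y. cinner (T x) y = cinner x (S y)"
  shows "cadjoint T = S"
  unfolding cadjoint_def
proof (rule the_equality)
  fix R assume R: "\<forall>x y. cinner (T x) y = cinner x (R y)"
  show "R = S"
    by (rule ext, rule cinner_eqI) (simp add: R flip: assms)
qed (simp add: assms)

text \<open>Riesz representation of \<open>\<lambda>x. cinner (T x) y\<close>, one \<open>y\<close>
  at a time, provides the map that the definite description in \<open>cadjoint\<close> asks
  for.\<close>

lemma cinner_cadjoint:
  fixes T :: "'a::chilbert_space \<Rightarrow> 'b::complex_inner"
  assumes T: "bounded_clinear T"
  shows "cinner (T x) y = cinner x (cadjoint T y)"
proof -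
  have "bounded_clinear (\<lambda>x. cinner (T x) y)" for y
  proof -
    have "bounded_linear (\<lambda>x. cinner (T x) y)"
      using T bounded_linear_compose[OF bounded_linear_cinner_left[of y], of T]
      by (simp add: bounded_clinear_def)
    then show ?thesis
      by (simp add: bounded_clinear_def[of "\<lambda>x. cinner (T x) y"] bounded_clinear_simps[OF T]
          cinner_simps scaleC_complex_def)
  qed
  from riesz_representation[OF this] obtain S where "\<And>x y. cinner (T x) y = cinner x (S y)"
    by metis
  then show ?thesis
    using cadjoint_eqI[of T S] by simp
qed

section \<open>Unitary operators between subspaces\<close>

lemma
  assumes "unitary_onto S T U"
  shows unitary_onto_add: "x \<in> S \<Longrightarrow> y \<in> S \<Longrightarrow> U (x + y) = U x + U y"
    and unitary_onto_scaleC: "x \<in> S \<Longrightarrow> U (c *\<^sub>C x) = c *\<^sub>C U x"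
    and unitary_onto_cinner: "x \<in> S \<Longrightarrow> y \<in> S \<Longrightarrow> cinner (U x) (U y) = cinner x y"
    and unitary_onto_in: "x \<in> S \<Longrightarrow> U x \<in> T"
    and unitary_onto_obtain: "z \<in> T \<Longrightarrow> \<exists>w\<in>S. z = U w"
    and unitary_onto_zero: "0 \<in> S \<Longrightarrow> U 0 = 0"
  using assms cinner_eq_zero_iff[of "U 0"] by (auto simp: unitary_onto_def)

lemma norm_unitary_onto:
  assumes "unitary_onto S T U" and "x \<in> S"
  shows "norm (U x) = norm x"
proof -
  have "complex_of_real ((norm (U x))\<^sup>2) = complex_of_real ((norm x)\<^sup>2)"
    using unitary_onto_cinner[OF assms(1) assms(2) assms(2)] by (simp add: cinner_self)
  then have "(norm (U x))\<^sup>2 = (norm x)\<^sup>2"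
    using of_real_eq_iff by blast
  then show ?thesis
    by (simp add: power2_eq_iff_nonneg)
qed

lemma bounded_clinear_unitary_onto:
  assumes "unitary_onto UNIV T U"
  shows "bounded_clinear U"
  by (rule bounded_clinearI[where K = 1])
    (use assms in \<open>auto simp: unitary_onto_def norm_unitary_onto[OF assms]\<close>)

text \<open>Preservation of inner products makes the adjoint a left inverse; on the range
  \<open>T\<close> it is then a right inverse as well. For \<open>M\<close> this range is the
  generic part.\<close>

lemma
  fixes U :: "'a::chilbert_space \<Rightarrow> 'b::complex_inner"
  assumes "unitary_onto UNIV T U"
  shows cadjoint_unitary_onto: "cadjoint U (U x) = x"
    and unitary_onto_cadjoint: "y \<in> T \<Longrightarrow> U (cadjoint U y) = y"
proof -
  show *: "cadjoint U (U x) = x" for x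
    by (rule cinner_eqI)
      (simp add: cinner_cadjoint[OF bounded_clinear_unitary_onto[OF assms], symmetric]
        unitary_onto_cinner[OF assms])
  show "U (cadjoint U y) = y" if "y \<in> T"
    using unitary_onto_obtain[OF assms that] by (auto simp: *)
qed

section \<open>Positive square roots\<close>

text \<open>Polarization: \<open>h\<close> measures the failure of symmetry and vanishes on the
  diagonal because the quadratic form is real; expanding it at \<open>x + y\<close> and
  \<open>x + \<i> *\<^sub>C y\<close> gives two equations that force
  \<open>h x y = 0\<close>.\<close>

lemma positive_operator_self_adjoint:
  assumes "positive_operator T"
  shows "cinner (T x) y = cinner x (T y)"
proof -
  have T: "bounded_clinear T" and real: "\<And>x. cinner (T x) x \<in> \<real>"
    using assms by (auto simp: positive_operator_def complex_is_Real_iff complex_nonneg_Reals_iff)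
  define h where "h x y = cinner (T x) y - cinner x (T y)" for x y
  have h0: "h x x = 0" for x
  proof -
    have "cinner (T x) x = cnj (cinner (T x) x)"
      using real[of x] by (simp add: Reals_cnj_iff)
    then show ?thesis by (simp add: h_def flip: cinner_commute)
  qed
  have "h x y + h y x = h (x + y) (x + y) - h x x - h y y"
    by (simp add: h_def cinner_simps bounded_clinear_simps[OF T])
  moreover have "\<i> * h y x - \<i> * h x y = h (x + \<i> *\<^sub>C y) (x + \<i> *\<^sub>C y) - h x x - h y y"
    by (simp add: h_def cinner_simps bounded_clinear_simps[OF T] algebra_simps)
  ultimately have "h x y + h y x = 0" "\<i> * h y x - \<i> * h x y = 0"
    by (simp_all add: h0)
  then have "h x y = 0" by simp
  then show ?thesis by (simp add: h_def)
qed

text \<open>The form at \<open>y + t *\<^sub>R T y\<close> is a quadratic in \<open>t\<close>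
  without constant term and with linear coefficient \<open>2 * (norm (T y))\<^sup>2\<close>. It is
  nonnegative for all real \<open>t\<close>, so that coefficient is zero.\<close>

lemma positive_operator_kernel:
  assumes pos: "positive_operator T" and zero: "Re (cinner (T y) y) = 0"
  shows "T y = 0"
proof -
  have T: "bounded_clinear T"
    using pos by (simp add: positive_operator_def)
  define z where "z = T y"
  define \<alpha> \<beta> where "\<alpha> = (norm z)\<^sup>2" and "\<beta> = Re (cinner (T z) z)"
  have "0 \<le> \<beta>"
    using pos by (auto simp: \<beta>_def positive_operator_def complex_nonneg_Reals_iff)
  have ineq: "0 \<le> 2 * t * \<alpha> + t\<^sup>2 * \<beta>" for t :: real
  proof -
    have "cinner (T z) y = complex_of_real \<alpha>"
      using positive_operator_self_adjoint[OF pos, of z y] by (simp add: z_def \<alpha>_def cinner_self)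
    moreover have "cinner (T y) z = complex_of_real \<alpha>"
      by (simp add: z_def \<alpha>_def cinner_self)
    ultimately have "Re (cinner (T (y + t *\<^sub>R z)) (y + t *\<^sub>R z)) = 2 * t * \<alpha> + t\<^sup>2 * \<beta>"
      using zero
      by (simp add: cinner_simps bounded_clinear_simps[OF T] \<beta>_def power2_eq_square algebra_simps)
    then show ?thesis
      using pos by (metis positive_operator_def complex_nonneg_Reals_iff)
  qed
  have "\<alpha> \<le> 0"
  proof (rule ccontr)
    assume "\<not> \<alpha> \<le> 0"
    then have "0 < \<alpha>" by simp
    \<comment> \<open>The \<open>+ 1\<close> keeps the denominator positive when \<beta> is zero and
      makes \<open>t * \<beta> + \<alpha>\<close> nonnegative.\<close>
    define t where "t = - \<alpha> / (\<beta> + 1)"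
    have "\<beta> * \<alpha> \<le> (\<beta> + 1) * \<alpha>" using \<open>0 < \<alpha>\<close> by simp
    then have "t * \<beta> + \<alpha> \<ge> 0"
      using \<open>0 \<le> \<beta>\<close> by (simp add: t_def field_simps)
    have "t < 0"
      using \<open>0 \<le> \<beta>\<close> \<open>0 < \<alpha>\<close> by (simp add: t_def divide_neg_pos)
    have "2 * t * \<alpha> + t\<^sup>2 * \<beta> = t * (\<alpha> + (t * \<beta> + \<alpha>))"
      by (simp add: power2_eq_square algebra_simps)
    also have "\<dots> < 0"
      using \<open>t < 0\<close> \<open>0 < \<alpha>\<close> \<open>t * \<beta> + \<alpha> \<ge> 0\<close> by (intro mult_neg_pos) auto
    finally show False using ineq[of t] by simp
  qed
  then show ?thesis by (simp add: \<alpha>_def z_def)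
qed

text \<open>
  With \<open>B = I - T\<close>, the equation \<open>S\<^sup>2 = T\<close> for \<open>S = I - L\<close> reads \<open>L = (B + L\<^sup>2) / 2\<close>. The
  iterates below converge to such an \<open>L\<close>, because their increments are dominated by those of
  the same recursion with \<open>B\<close> replaced by the number 1.
\<close>

primrec sqrt_iter :: "('a::real_vector \<Rightarrow> 'a) \<Rightarrow> nat \<Rightarrow> 'a \<Rightarrow> 'a" where
  "sqrt_iter B 0 = (\<lambda>x. 0)"
| "sqrt_iter B (Suc n) = (\<lambda>x. (1/2) *\<^sub>R (B x + sqrt_iter B n (sqrt_iter B n x)))"

primrec sqrt_majorant :: "nat \<Rightarrow> real" where
  "sqrt_majorant 0 = 0"
| "sqrt_majorant (Suc n) = (1 + (sqrt_majorant n)\<^sup>2) / 2"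

section \<open>Estimates for the iterates and their majorant\<close>

lemma sqrt_majorant_bounds: "0 \<le> sqrt_majorant n \<and> sqrt_majorant n \<le> 1"
  by (induction n) (auto simp: power_le_one)

lemma sqrt_majorant_mono: "incseq sqrt_majorant"
proof (rule incseq_SucI)
  fix n
  have "0 \<le> (1 - sqrt_majorant n)\<^sup>2" by simp
  then show "sqrt_majorant n \<le> sqrt_majorant (Suc n)"
    by (simp add: power2_eq_square algebra_simps)
qed

lemma sqrt_majorant_Cauchy: "Cauchy sqrt_majorant"
  by (rule convergent_Cauchy, rule Bseq_monoseq_convergent)
    (use sqrt_majorant_bounds sqrt_majorant_mono in
      \<open>auto intro!: BseqI'[of _ 1] incseq_imp_monoseq\<close>)

text \<open>The iterates are polynomials in \<open>B\<close>. Taking \<open>R\<close> to be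
  \<open>B\<close> or another iterate shows that they commute with one another.\<close>

lemma sqrt_iter_commute:
  assumes R: "linear R" and comm: "\<And>x. R (B x) = B (R x)"
  shows "R (sqrt_iter B n x) = sqrt_iter B n (R x)"
  by (induction n arbitrary: x)
    (simp_all add: linear_0[OF R] linear_scale[OF R] linear_add[OF R] comm)

lemma linear_sqrt_iter: "linear B \<Longrightarrow> linear (sqrt_iter B n)"
proof (induction n)
  case (Suc n)
  note lin = \<open>linear B\<close> Suc.IH[OF \<open>linear B\<close>]
  show ?case
    by (rule linearI)
      (simp_all add: lin[THEN linear_add] lin[THEN linear_scale] algebra_simps)
qed (simp add: module_hom_zero)

lemma norm_sqrt_iter_le:
  fixes B :: "'a::real_normed_vector \<Rightarrow> 'a"
  assumes "\<And>x. norm (B x) \<le> norm x"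
  shows "norm (sqrt_iter B n x) \<le> sqrt_majorant n * norm x"
proof (induction n arbitrary: x)
  case (Suc n)
  have "norm (B x + sqrt_iter B n (sqrt_iter B n x)) \<le>
      norm x + sqrt_majorant n * (sqrt_majorant n * norm x)"
    by (intro order.trans[OF norm_triangle_ineq] add_mono assms order.trans[OF Suc]
        mult_left_mono Suc) (simp add: sqrt_majorant_bounds)
  then show ?case
    by (simp add: power2_eq_square ring_distribs mult.assoc del: scaleR_add_right)
qed simp

text \<open>Consecutive iterates commute, so the difference of their squares factors as sum times
  difference; the numbers of the majorant factor in the same way, which closes the
  induction.\<close>

lemma norm_sqrt_iter_Suc_diff_le:
  fixes B :: "'a::real_normed_vector \<Rightarrow> 'a"
  assumes lin: "linear B" and nrm: "\<And>x. norm (B x) \<le> norm x"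
  shows "norm (sqrt_iter B (Suc n) x - sqrt_iter B n x) \<le>
    (sqrt_majorant (Suc n) - sqrt_majorant n) * norm x"
proof (induction n arbitrary: x)
  case 0
  show ?case using nrm[of x] by simp
next
  case (Suc n)
  define Y Z where "Y = sqrt_iter B (Suc n)" and "Z = sqrt_iter B n"
  define r q where "r = sqrt_majorant (Suc n)" and "q = sqrt_majorant n"
  have Y: "linear Y" and Z: "linear Z"
    unfolding Y_def Z_def by (intro linear_sqrt_iter lin)+
  have ZB: "Z (B x) = B (Z x)" for x
    unfolding Z_def by (rule sqrt_iter_commute[OF lin, symmetric]) simp
  have YZ: "Z (Y x) = Y (Z x)" for x
    unfolding Y_def by (rule sqrt_iter_commute[OF Z, where B = B]) (rule ZB)
  have bounds: "0 \<le> q" "0 \<le> r" "q \<le> r"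
    using sqrt_majorant_bounds incseqD[OF sqrt_majorant_mono, of n "Suc n"]
    by (auto simp: q_def r_def)
  have "sqrt_iter B (Suc (Suc n)) x - sqrt_iter B (Suc n) x = (1/2) *\<^sub>R (Y (Y x) - Z (Z x))"
    unfolding sqrt_iter.simps(2)[of B "Suc n"] sqrt_iter.simps(2)[of B n]
      Y_def[symmetric] Z_def[symmetric]
    by (simp add: algebra_simps Y_def Z_def)
  also have "Y (Y x) - Z (Z x) = Y (Y x - Z x) + Z (Y x - Z x)"
    by (simp add: linear_diff[OF Y] linear_diff[OF Z] YZ)
  finally have eq: "sqrt_iter B (Suc (Suc n)) x - sqrt_iter B (Suc n) x =
      (1/2) *\<^sub>R (Y (Y x - Z x) + Z (Y x - Z x))" .
  have "norm (Y (Y x - Z x) + Z (Y x - Z x)) \<le> (r + q) * norm (Y x - Z x)"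
    unfolding distrib_right Y_def Z_def r_def q_def
    by (intro order.trans[OF norm_triangle_ineq] add_mono norm_sqrt_iter_le nrm)
  also have "\<dots> \<le> (r + q) * (r - q) * norm x"
    unfolding mult.assoc using Suc[of x] bounds
    by (intro mult_left_mono) (auto simp: Y_def Z_def r_def q_def)
  also have "(r + q) * (r - q) = 2 * (sqrt_majorant (Suc (Suc n)) - r)"
    unfolding sqrt_majorant.simps(2)[of "Suc n"] r_def[symmetric]
    unfolding r_def sqrt_majorant.simps(2)[of n] q_def
    by (simp add: field_simps power2_eq_square)
  finally show ?case
    unfolding eq norm_scaleR r_def by (simp add: algebra_simps del: sqrt_majorant.simps)
qed

lemma norm_sqrt_iter_diff_le:
  fixes B :: "'a::real_normed_vector \<Rightarrow> 'a"
  assumes "linear B" and "\<And>x. norm (B x) \<le> norm x" and "m \<le> n"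
  shows "norm (sqrt_iter B n x - sqrt_iter B m x) \<le> (sqrt_majorant n - sqrt_majorant m) * norm x"
  using \<open>m \<le> n\<close>
proof (induction n rule: dec_induct)
  case (step n)
  have "sqrt_iter B (Suc n) x - sqrt_iter B m x =
      (sqrt_iter B (Suc n) x - sqrt_iter B n x) + (sqrt_iter B n x - sqrt_iter B m x)"
    by simp
  also have "norm \<dots> \<le> (sqrt_majorant (Suc n) - sqrt_majorant n) * norm x +
      (sqrt_majorant n - sqrt_majorant m) * norm x"
    by (intro order.trans[OF norm_triangle_ineq] add_mono step
        norm_sqrt_iter_Suc_diff_le assms)
  finally show ?case by (simp add: algebra_simps)
qed simp

text \<open>By \<open>nrm\<close> the operator \<open>I - T\<close> is a contraction. So is the
  limit \<open>L\<close> of the iterates, which makes \<open>I - L\<close> positive. The commutation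
  clause survives the limit; uniqueness and the block computations rest on it.\<close>

lemma positive_sqrt_exists:
  fixes T :: "'a::chilbert_space \<Rightarrow> 'a"
  assumes T: "bounded_clinear T" and sa: "\<And>x y. cinner (T x) y = cinner x (T y)"
    and nrm: "\<And>x. norm (x - T x) \<le> norm x"
  shows "\<exists>S. positive_operator S \<and> S \<circ> S = T \<and>
    (\<forall>R. bounded_linear R \<longrightarrow> R \<circ> T = T \<circ> R \<longrightarrow> R \<circ> S = S \<circ> R)"
proof -
  define B where "B x = x - T x" for x
  have B: "bounded_clinear B"
    unfolding B_def by (intro bounded_clinear_sub bounded_clinear_id T)
  have Bn: "norm (B x) \<le> norm x" for x
    using nrm by (simp add: B_def)
  have lin: "linear B"
    using B by (simp add: bounded_clinear_def bounded_linear.linear)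
  note bnd = norm_sqrt_iter_diff_le[OF lin Bn]
  have "Cauchy (\<lambda>n. sqrt_iter B n x)" for x
  proof (rule metric_CauchyI)
    fix e :: real assume "0 < e"
    then have "0 < e / (norm x + 1)"
      by (simp add: add_nonneg_pos)
    from metric_CauchyD[OF sqrt_majorant_Cauchy this] obtain N
      where N: "\<And>m n. N \<le> m \<Longrightarrow> N \<le> n \<Longrightarrow>
        dist (sqrt_majorant m) (sqrt_majorant n) < e / (norm x + 1)"
      by blast
    have le: "dist (sqrt_iter B n x) (sqrt_iter B m x) < e" if "N \<le> m" "m \<le> n" for m n
    proof -
      have "sqrt_majorant n - sqrt_majorant m \<le> e / (norm x + 1)"
        using N[of n m] that by (simp add: dist_real_def)
      with bnd[OF that(2), of x] have "dist (sqrt_iter B n x) (sqrt_iter B m x) \<le> e / (norm x + 1) * norm x"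
        unfolding dist_norm by (meson mult_right_mono norm_ge_zero order.trans)
      also have "\<dots> < e"
        using \<open>0 < e\<close> add_nonneg_pos[of "norm x" 1] by (simp add: pos_divide_less_eq algebra_simps)
      finally show ?thesis .
    qed
    have "dist (sqrt_iter B m x) (sqrt_iter B n x) < e" if "N \<le> m" "N \<le> n" for m n
      using le[OF that(1), of n] le[OF that(2), of m] by (cases "m \<le> n") (auto simp: dist_commute)
    then show "\<exists>N. \<forall>m\<ge>N. \<forall>n\<ge>N. dist (sqrt_iter B m x) (sqrt_iter B n x) < e" by blast
  qed
  then have "\<exists>l. (\<lambda>n. sqrt_iter B n x) \<longlonglongrightarrow> l" for x
    using Cauchy_convergent convergent_def by blast
  then obtain L where L: "\<And>x. (\<lambda>n. sqrt_iter B n x) \<longlonglongrightarrow> L x"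
    by metis
  have le1: "norm (sqrt_iter B n x) \<le> norm x" for n x
    using norm_sqrt_iter_le[OF Bn, of n x] sqrt_majorant_bounds[of n]
    by (meson mult_left_le_one_le norm_ge_zero order.trans)
  have Ln: "norm (L x) \<le> norm x" for x
    by (rule tendsto_upperbound[OF tendsto_norm[OF L]]) (simp_all add: le1)
  have Lcomm: "R (L x) = L (R x)" if R: "bounded_linear R" and c: "\<And>x. R (B x) = B (R x)" for R x
  proof (rule LIMSEQ_unique[OF _ L])
    show "(\<lambda>n. sqrt_iter B n (R x)) \<longlonglongrightarrow> R (L x)"
      using bounded_linear.tendsto[OF R L, of x] sqrt_iter_commute[OF bounded_linear.linear[OF R], where B = B, OF c]
      by simp
  qed
  have Lc: "bounded_clinear L"
  proof (rule bounded_clinearI[where K = 1])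
    show "L (x + y) = L x + L y" for x y
    proof (rule LIMSEQ_unique[OF L])
      show "(\<lambda>n. sqrt_iter B n (x + y)) \<longlonglongrightarrow> L x + L y"
        using tendsto_add[OF L L, of x y] by (simp add: linear_add[OF linear_sqrt_iter[OF lin]])
    qed
    \<comment> \<open>Complex homogeneity is an instance of \<open>Lcomm\<close>: multiplication by
      \<open>c\<close> is a bounded real linear map commuting with \<open>B\<close>.\<close>
    show "L (c *\<^sub>C x) = c *\<^sub>C L x" for c x
    proof (rule Lcomm[symmetric])
      show "bounded_linear ((*\<^sub>C) c :: 'a \<Rightarrow> 'a)"
        by (rule bounded_linear_intro[where K = "cmod c"])
          (simp_all add: scaleC_add_right scaleR_scaleC scaleC_scaleC norm_scaleC mult.commute)
    qed (simp add: bounded_clinear_scaleC[OF B])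
    show "norm (L x) \<le> norm x * 1" for x by (simp add: Ln)
  qed
  have Lsa: "cinner (L x) y = cinner x (L y)" for x y
  proof -
    have "cinner (sqrt_iter B n x) y = cinner x (sqrt_iter B n y)" for n
      by (induction n arbitrary: x y) (simp_all add: cinner_simps B_def sa)
    with tendsto_cinner_left[OF L, of x y] have "(\<lambda>n. cinner x (sqrt_iter B n y)) \<longlonglongrightarrow> cinner (L x) y"
      by simp
    then show ?thesis
      using tendsto_cinner_right[OF L] LIMSEQ_unique by blast
  qed
  have Leq: "2 *\<^sub>R L x = B x + L (L x)" for x
  proof -
    \<comment> \<open>Operator and argument vary together; since the iterates are contractions,
      replacing the inner iterate by its limit costs an error tending to 0.\<close>
    have "(\<lambda>n. sqrt_iter B n (sqrt_iter B n x - L x)) \<longlonglongrightarrow> 0"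
    proof (rule Lim_null_comparison)
      show "(\<lambda>n. norm (sqrt_iter B n x - L x)) \<longlonglongrightarrow> 0"
        using L[of x] by (simp add: tendsto_norm_zero LIM_zero)
    qed (simp add: le1)
    then have "(\<lambda>n. sqrt_iter B n (sqrt_iter B n x)) \<longlonglongrightarrow> L (L x)"
      using tendsto_add[OF _ L[of "L x"]]
      by (fastforce simp: linear_diff[OF linear_sqrt_iter[OF lin]])
    then have "(\<lambda>n. sqrt_iter B (Suc n) x) \<longlonglongrightarrow> (1/2) *\<^sub>R (B x + L (L x))"
      by (auto intro!: tendsto_intros)
    then have "L x = (1/2) *\<^sub>R (B x + L (L x))"
      using LIMSEQ_Suc[OF L] LIMSEQ_unique by blast
    moreover have "2 *\<^sub>R (1/2) *\<^sub>R z = z" for z :: 'a by simp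
    ultimately show ?thesis by metis
  qed
  define S where "S x = x - L x" for x
  have S: "bounded_clinear S"
    unfolding S_def by (intro bounded_clinear_sub bounded_clinear_id Lc)
  have "positive_operator S"
    unfolding positive_operator_def complex_nonneg_Reals_iff
  proof (intro conjI allI S)
    fix x
    have "cinner (S x) x = cnj (cinner (S x) x)"
      unfolding cinner_commute[of x "S x", symmetric] by (simp add: S_def cinner_simps Lsa)
    then show "Im (cinner (S x) x) = 0"
      by (metis Reals_cnj_iff complex_is_Real_iff)
    have "Re (cinner (L x) x) \<le> norm x * norm x"
      using norm_cinner_le[of "L x" x] Ln[of x] complex_Re_le_cmod[of "cinner (L x) x"]
      by (meson mult_right_mono norm_ge_zero order.trans)
    then show "0 \<le> Re (cinner (S x) x)"
      by (simp add: S_def cinner_simps cinner_self power2_eq_square)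
  qed
  moreover have "S \<circ> S = T"
  proof
    fix x
    have "S (S x) = x - 2 *\<^sub>R L x + L (L x)"
      by (simp add: S_def bounded_clinear_simps[OF Lc] scaleR_2)
    then show "(S \<circ> S) x = T x"
      by (simp add: Leq B_def)
  qed
  moreover have "R \<circ> S = S \<circ> R" if "bounded_linear R" "R \<circ> T = T \<circ> R" for R
  proof
    fix x
    have "R (B x) = B (R x)" for x
      using that by (simp add: B_def linear_diff bounded_linear.linear fun_eq_iff)
    then show "(R \<circ> S) x = (S \<circ> R) x"
      using Lcomm[OF that(1)] that(1) by (simp add: S_def linear_diff bounded_linear.linear)
  qed
  ultimately show ?thesis by blast
qed

text \<open>With \<open>y = S x - R x\<close>, commutation gives \<open>S y + R y = 0\<close>. Both
  quadratic forms then vanish at \<open>y\<close>, hence \<open>S y = R y = 0\<close>, and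
  \<open>cinner y y\<close> equals \<open>cinner x (S y - R y)\<close>.\<close>

lemma positive_sqrt_unique:
  assumes S: "positive_operator S" and R: "positive_operator R" and sq: "S \<circ> S = R \<circ> R"
    and comm: "R \<circ> S = S \<circ> R"
  shows "R = S"
proof
  fix x
  have lin: "bounded_clinear S" "bounded_clinear R"
    using S R by (auto simp: positive_operator_def)
  note simps = lin[THEN bounded_clinear_diff]
  define y where "y = S x - R x"
  have "S y + R y = 0"
    using fun_cong[OF sq, of x] fun_cong[OF comm, of x] by (simp add: y_def simps)
  then have "Re (cinner (S y) y) + Re (cinner (R y) y) = 0"
    by (metis cinner_add_left cinner_zero_left plus_complex.sel(1) zero_complex.sel(1))
  then have "Re (cinner (S y) y) = 0" "Re (cinner (R y) y) = 0"
    using S R by (auto simp: positive_operator_def complex_nonneg_Reals_iff add_nonneg_eq_0_iff)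
  then have "S y = 0" "R y = 0"
    using positive_operator_kernel S R by blast+
  moreover have "cinner y y = cinner x (S y - R y)"
    by (simp add: y_def cinner_simps simps positive_operator_self_adjoint[OF S]
        positive_operator_self_adjoint[OF R])
  ultimately show "R x = S x"
    by (simp add: y_def)
qed

text \<open>A positive root \<open>A\<close> commutes with its square \<open>T\<close>, hence with
  the root \<open>S\<close> constructed before, so \<open>positive_sqrt_unique\<close> applies. The
  description in \<open>operator_sqrt\<close> thus denotes \<open>S\<close> and inherits its
  commutation property.\<close>

lemma
  fixes T :: "'a::chilbert_space \<Rightarrow> 'a"
  assumes T: "bounded_clinear T" and sa: "\<And>x y. cinner (T x) y = cinner x (T y)"
    and nrm: "\<And>x. norm (x - T x) \<le> norm x"
  shows positive_operator_sqrt: "positive_operator (operator_sqrt T)"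
    and operator_sqrt_square: "operator_sqrt T \<circ> operator_sqrt T = T"
    and operator_sqrt_commute:
      "bounded_linear R \<Longrightarrow> R \<circ> T = T \<circ> R \<Longrightarrow> R \<circ> operator_sqrt T = operator_sqrt T \<circ> R"
    and operator_sqrt_eqI: "positive_operator A \<Longrightarrow> A \<circ> A = T \<Longrightarrow> operator_sqrt T = A"
proof -
  obtain S where S: "positive_operator S" "S \<circ> S = T"
    and comm: "\<And>R. bounded_linear R \<Longrightarrow> R \<circ> T = T \<circ> R \<Longrightarrow> R \<circ> S = S \<circ> R"
    using positive_sqrt_exists[OF assms] by blast
  have uniq: "A = S" if A: "positive_operator A" "A \<circ> A = T" for A
  proof (rule positive_sqrt_unique[OF S(1) A(1)])
    have "bounded_linear A"
      using A by (simp add: positive_operator_def bounded_clinear_def)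
    moreover have "A \<circ> T = T \<circ> A"
      unfolding A(2)[symmetric] by (rule comp_assoc[symmetric])
    ultimately show "A \<circ> S = S \<circ> A" by (rule comm)
  qed (simp add: S A)
  have eq: "operator_sqrt T = S"
    unfolding operator_sqrt_def
    by (rule the_equality) (use S in simp, use uniq in blast)
  show "positive_operator (operator_sqrt T)" "operator_sqrt T \<circ> operator_sqrt T = T"
    unfolding eq by (rule S)+
  show "R \<circ> operator_sqrt T = operator_sqrt T \<circ> R" if "bounded_linear R" "R \<circ> T = T \<circ> R"
    unfolding eq by (rule comm[OF that])
  show "operator_sqrt T = A" if "positive_operator A" "A \<circ> A = T"
    unfolding eq by (rule uniq[OF that, symmetric])
qed

section \<open>The decomposition defined by two projections\<close>

text \<open>The last two facts turn membership in the four subspaces into eigenvalue equations for 1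
  and 0.\<close>

lemma
  fixes P :: "'a::chilbert_space \<Rightarrow> 'a"
  assumes "orthogonal_projection P"
  shows orthogonal_projection_clinear: "bounded_clinear P"
    and orthogonal_projection_idem: "P (P x) = P x"
    and orthogonal_projection_self_adjoint: "cinner (P x) y = cinner x (P y)"
    and range_orthogonal_projection: "range P = {x. P x = x}"
    and orth_compl_range_orthogonal_projection: "orth_compl (range P) = {x. P x = 0}"
proof -
  have P: "bounded_clinear P" "P \<circ> P = P" "cadjoint P = P"
    using assms by (auto simp: orthogonal_projection_def)
  show "bounded_clinear P" by (rule P)
  show idem: "P (P x) = P x" for x
    using fun_cong[OF P(2), of x] by simp
  show sa: "cinner (P x) y = cinner x (P y)" for x y
    using cinner_cadjoint[OF P(1), of x y] P(3) by simp
  show "range P = {x. P x = x}"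
    using idem by (auto intro: range_eqI[OF sym])
  show "orth_compl (range P) = {x. P x = 0}"
  proof (intro equalityI subsetI)
    fix x assume "x \<in> orth_compl (range P)"
    then have "cinner x (P (P x)) = 0" by (simp add: orth_compl_def)
    then have "cinner (P x) (P x) = 0" by (simp only: sa)
    then show "x \<in> {x. P x = 0}" by simp
  qed (auto simp: orth_compl_def simp flip: sa)
qed

locale projection_pair =
  fixes P Q :: "'h::chilbert_space \<Rightarrow> 'h"
  assumes P: "orthogonal_projection P" and Q: "orthogonal_projection Q"
begin

lemmas linP = bounded_clinear_simps[OF orthogonal_projection_clinear[OF P]]
lemmas linQ = bounded_clinear_simps[OF orthogonal_projection_clinear[OF Q]]
lemmas saP = orthogonal_projection_self_adjoint[OF P]
lemmas saQ = orthogonal_projection_self_adjoint[OF Q]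

lemma M00_iff: "x \<in> M00 P Q \<longleftrightarrow> P x = x \<and> Q x = x"
  and M01_iff: "x \<in> M01 P Q \<longleftrightarrow> P x = x \<and> Q x = 0"
  and M10_iff: "x \<in> M10 P Q \<longleftrightarrow> P x = 0 \<and> Q x = x"
  and M11_iff: "x \<in> M11 P Q \<longleftrightarrow> P x = 0 \<and> Q x = 0"
  unfolding M00_def M01_def M10_def M11_def
    orth_compl_range_orthogonal_projection[OF P] orth_compl_range_orthogonal_projection[OF Q]
  by (auto simp: range_orthogonal_projection[OF P] range_orthogonal_projection[OF Q])

lemmas M_iffs = M00_iff M01_iff M10_iff M11_iff

lemma generic_part_iff:
  "x \<in> generic_part P Q \<longleftrightarrow>
    (\<forall>y \<in> M00 P Q \<union> M01 P Q \<union> M10 P Q \<union> M11 P Q. cinner x y = 0)"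
proof
  assume x: "x \<in> generic_part P Q"
  have "0 \<in> M00 P Q" "0 \<in> M01 P Q" "0 \<in> M10 P Q" "0 \<in> M11 P Q"
    by (simp_all add: M_iffs linP linQ)
  then have "M00 P Q \<union> M01 P Q \<union> M10 P Q \<union> M11 P Q \<subseteq>
      M00 P Q + M01 P Q + M10 P Q + M11 P Q"
    by (force simp: set_plus_def)
  then show "\<forall>y \<in> M00 P Q \<union> M01 P Q \<union> M10 P Q \<union> M11 P Q. cinner x y = 0"
    using x by (auto simp: generic_part_def orth_compl_def)
next
  assume "\<forall>y \<in> M00 P Q \<union> M01 P Q \<union> M10 P Q \<union> M11 P Q. cinner x y = 0"
  then show "x \<in> generic_part P Q"
    by (auto simp: generic_part_def orth_compl_def set_plus_def cinner_simps)
qed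

lemma subspace_parts:
  "complex_vector.subspace (M00 P Q)" "complex_vector.subspace (M01 P Q)"
  "complex_vector.subspace (M10 P Q)" "complex_vector.subspace (M11 P Q)"
  "complex_vector.subspace (generic_part P Q)"
  by (auto simp: complex_vector.subspace_def M_iffs linP linQ generic_part_def
      subspace_orth_compl[unfolded complex_vector.subspace_def])

lemma closed_parts:
  "closed (M00 P Q)" "closed (M01 P Q)" "closed (M10 P Q)" "closed (M11 P Q)"
proof -
  have "continuous_on UNIV P" "continuous_on UNIV Q"
    using orthogonal_projection_clinear[OF P] orthogonal_projection_clinear[OF Q]
    by (auto simp: bounded_clinear_def intro: linear_continuous_on)
  then have cl: "closed {x. P x = x}" "closed {x. P x = 0}" "closed {x. Q x = x}" "closed {x. Q x = 0}"
    by (auto intro!: closed_Collect_eq continuous_intros)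
  have eqs: "M00 P Q = {x. P x = x} \<inter> {x. Q x = x}" "M01 P Q = {x. P x = x} \<inter> {x. Q x = 0}"
    "M10 P Q = {x. P x = 0} \<inter> {x. Q x = x}" "M11 P Q = {x. P x = 0} \<inter> {x. Q x = 0}"
    by (auto simp: M_iffs)
  show "closed (M00 P Q)" "closed (M01 P Q)" "closed (M10 P Q)" "closed (M11 P Q)"
    unfolding eqs by (intro closed_Int cl)+
qed

text \<open>On each of the four subspaces \<open>P\<close> and \<open>Q\<close> act as 0 or as the
  identity; self-adjointness moves them onto the test vector.\<close>

lemma generic_part_invariant:
  assumes x: "x \<in> generic_part P Q"
  shows "P x \<in> generic_part P Q" and "Q x \<in> generic_part P Q"
proof -
  have "cinner (P x) y = 0 \<and> cinner (Q x) y = 0"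
    if y: "y \<in> M00 P Q \<union> M01 P Q \<union> M10 P Q \<union> M11 P Q" for y
  proof -
    have "P y = y \<or> P y = 0" "Q y = y \<or> Q y = 0"
      using y by (auto simp: M_iffs)
    then show ?thesis
      using x y unfolding saP saQ generic_part_iff by (metis cinner_zero_right)
  qed
  then show "P x \<in> generic_part P Q" "Q x \<in> generic_part P Q"
    by (auto simp: generic_part_iff)
qed

section \<open>Components with respect to the five summands\<close>

definition parts :: "'h \<Rightarrow> 'h \<Rightarrow> 'h \<Rightarrow> 'h \<Rightarrow> 'h \<Rightarrow> bool" where
  "parts x00 x01 x10 x11 xg \<longleftrightarrow> x00 \<in> M00 P Q \<and> x01 \<in> M01 P Q \<and> x10 \<in> M10 P Q \<and>
    x11 \<in> M11 P Q \<and> xg \<in> generic_part P Q"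

lemma parts_orthogonal:
  assumes x: "parts x00 x01 x10 x11 xg" and y: "parts y00 y01 y10 y11 yg"
  shows "cinner x00 y01 = 0" "cinner x00 y10 = 0" "cinner x00 y11 = 0" "cinner x00 yg = 0"
    "cinner x01 y00 = 0" "cinner x01 y10 = 0" "cinner x01 y11 = 0" "cinner x01 yg = 0"
    "cinner x10 y00 = 0" "cinner x10 y01 = 0" "cinner x10 y11 = 0" "cinner x10 yg = 0"
    "cinner x11 y00 = 0" "cinner x11 y01 = 0" "cinner x11 y10 = 0" "cinner x11 yg = 0"
    "cinner xg y00 = 0" "cinner xg y01 = 0" "cinner xg y10 = 0" "cinner xg y11 = 0"
proof -
  \<comment> \<open>Any two distinct subspaces among the four lie in different eigenspaces, for 0
    and 1, of \<open>P\<close> or of \<open>Q\<close>.\<close>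
  have *: "cinner u w = 0" if "P u = u \<and> P w = 0 \<or> Q u = u \<and> Q w = 0 \<or>
      P u = 0 \<and> P w = w \<or> Q u = 0 \<and> Q w = w" for u w
    using that saP[of u w] saQ[of u w] by auto
  note xy = x[unfolded parts_def M_iffs] y[unfolded parts_def M_iffs]
  show "cinner x00 y01 = 0" "cinner x00 y10 = 0" "cinner x00 y11 = 0"
    "cinner x01 y00 = 0" "cinner x01 y10 = 0" "cinner x01 y11 = 0"
    "cinner x10 y00 = 0" "cinner x10 y01 = 0" "cinner x10 y11 = 0"
    "cinner x11 y00 = 0" "cinner x11 y01 = 0" "cinner x11 y10 = 0"
    by (rule *, use xy in blast)+
  show "cinner x00 yg = 0" "cinner x01 yg = 0" "cinner x10 yg = 0" "cinner x11 yg = 0"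
    using x y unfolding parts_def generic_part_iff cinner_zero_commute[of _ yg] by blast+
  show "cinner xg y00 = 0" "cinner xg y01 = 0" "cinner xg y10 = 0" "cinner xg y11 = 0"
    using x y unfolding parts_def generic_part_iff by blast+
qed

lemma cinner_parts:
  assumes "parts x00 x01 x10 x11 xg" and "parts y00 y01 y10 y11 yg"
  shows "cinner (x00 + x01 + x10 + x11 + xg) (y00 + y01 + y10 + y11 + yg) =
    cinner x00 y00 + cinner x01 y01 + cinner x10 y10 + cinner x11 y11 + cinner xg yg"
  by (simp add: cinner_simps parts_orthogonal[OF assms])

lemma parts_zero:
  "0 \<in> M00 P Q" "0 \<in> M01 P Q" "0 \<in> M10 P Q" "0 \<in> M11 P Q" "0 \<in> generic_part P Q"
  by (intro subspace_parts[THEN complex_vector.subspace_0])+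

lemma orth_proj_parts:
  assumes x: "parts x00 x01 x10 x11 xg"
  defines "x \<equiv> x00 + x01 + x10 + x11 + xg"
  shows "orth_proj (M00 P Q) x = x00" "orth_proj (M01 P Q) x = x01"
    "orth_proj (M10 P Q) x = x10" "orth_proj (M11 P Q) x = x11"
    "orth_proj (generic_part P Q) x = xg"
proof -
  note x' = x[unfolded parts_def]
  \<comment> \<open>A test vector from one summand is padded with zeros to a full tuple, so that
    \<open>parts_orthogonal\<close> applies to it.\<close>
  have 0: "parts y00 0 0 0 0" if "y00 \<in> M00 P Q" for y00 using that by (simp add: parts_def parts_zero)
  have 1: "parts 0 y01 0 0 0" if "y01 \<in> M01 P Q" for y01 using that by (simp add: parts_def parts_zero)
  have 2: "parts 0 0 y10 0 0" if "y10 \<in> M10 P Q" for y10 using that by (simp add: parts_def parts_zero)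
  have 3: "parts 0 0 0 y11 0" if "y11 \<in> M11 P Q" for y11 using that by (simp add: parts_def parts_zero)
  have 4: "parts 0 0 0 0 yg" if "yg \<in> generic_part P Q" for yg using that by (simp add: parts_def parts_zero)
  show "orth_proj (M00 P Q) x = x00"
    by (rule orth_proj_eqI[OF subspace_parts(1)])
      (use x' in \<open>simp_all add: orth_compl_def x_def cinner_simps parts_orthogonal[OF x 0]\<close>)
  show "orth_proj (M01 P Q) x = x01"
    by (rule orth_proj_eqI[OF subspace_parts(2)])
      (use x' in \<open>simp_all add: orth_compl_def x_def cinner_simps parts_orthogonal[OF x 1]\<close>)
  show "orth_proj (M10 P Q) x = x10"
    by (rule orth_proj_eqI[OF subspace_parts(3)])
      (use x' in \<open>simp_all add: orth_compl_def x_def cinner_simps parts_orthogonal[OF x 2]\<close>)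
  show "orth_proj (M11 P Q) x = x11"
    by (rule orth_proj_eqI[OF subspace_parts(4)])
      (use x' in \<open>simp_all add: orth_compl_def x_def cinner_simps parts_orthogonal[OF x 3]\<close>)
  show "orth_proj (generic_part P Q) x = xg"
    by (rule orth_proj_eqI[OF subspace_parts(5)])
      (use x' in \<open>simp_all add: orth_compl_def x_def cinner_simps parts_orthogonal[OF x 4]\<close>)
qed

text \<open>Subtracting the four projections leaves a vector orthogonal to each subspace:
  \<open>x\<close> minus the projection onto that subspace is, and the other three projections lie
  in orthogonal subspaces.\<close>

lemma parts_obtain:
  obtains x00 x01 x10 x11 xg where "parts x00 x01 x10 x11 xg" and "x = x00 + x01 + x10 + x11 + xg"
proof -
  define x00 x01 x10 x11 where "x00 = orth_proj (M00 P Q) x" and "x01 = orth_proj (M01 P Q) x"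
    and "x10 = orth_proj (M10 P Q) x" and "x11 = orth_proj (M11 P Q) x"
  define xg where "xg = x - x00 - x01 - x10 - x11"
  have x: "x00 \<in> M00 P Q" "x01 \<in> M01 P Q" "x10 \<in> M10 P Q" "x11 \<in> M11 P Q"
    unfolding x00_def x01_def x10_def x11_def
    by (intro orth_proj_in subspace_parts closed_parts)+
  have 0: "parts x00 x01 x10 x11 0"
    using x by (simp add: parts_def parts_zero)
  have d: "x - x00 \<in> orth_compl (M00 P Q)" "x - x01 \<in> orth_compl (M01 P Q)"
    "x - x10 \<in> orth_compl (M10 P Q)" "x - x11 \<in> orth_compl (M11 P Q)"
    unfolding x00_def x01_def x10_def x11_def
    by (intro diff_orth_proj_in subspace_parts closed_parts)+
  have "cinner xg y = 0" if y: "y \<in> M00 P Q \<union> M01 P Q \<union> M10 P Q \<union> M11 P Q" for y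
  proof -
    consider "y \<in> M00 P Q" | "y \<in> M01 P Q" | "y \<in> M10 P Q" | "y \<in> M11 P Q"
      using y by blast
    then show ?thesis
    proof cases
      case 1
      then have "parts y 0 0 0 0" by (simp add: parts_def parts_zero)
      from parts_orthogonal[OF 0 this] orth_complD[OF d(1) 1] show ?thesis
        by (simp add: xg_def cinner_simps)
    next
      case 2
      then have "parts 0 y 0 0 0" by (simp add: parts_def parts_zero)
      from parts_orthogonal[OF 0 this] orth_complD[OF d(2) 2] show ?thesis
        by (simp add: xg_def cinner_simps)
    next
      case 3
      then have "parts 0 0 y 0 0" by (simp add: parts_def parts_zero)
      from parts_orthogonal[OF 0 this] orth_complD[OF d(3) 3] show ?thesis
        by (simp add: xg_def cinner_simps)
    next
      case 4
      then have "parts 0 0 0 y 0" by (simp add: parts_def parts_zero)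
      from parts_orthogonal[OF 0 this] orth_complD[OF d(4) 4] show ?thesis
        by (simp add: xg_def cinner_simps)
    qed
  qed
  then have "parts x00 x01 x10 x11 xg"
    using x by (simp add: parts_def generic_part_iff)
  moreover have "x = x00 + x01 + x10 + x11 + xg"
    by (simp add: xg_def)
  ultimately show ?thesis by (rule that)
qed

lemma norm_diff_projections_le: "norm (P x - Q x) \<le> norm x"
proof -
  have "cinner (P x - Q x) (P x - Q x) + cinner (x - P x - Q x) (x - P x - Q x) = cinner x x"
    by (simp add: cinner_simps saP saQ linP linQ orthogonal_projection_idem[OF P]
        orthogonal_projection_idem[OF Q])
  then have "complex_of_real ((norm (P x - Q x))\<^sup>2 + (norm (x - P x - Q x))\<^sup>2) =
      complex_of_real ((norm x)\<^sup>2)"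
    by (simp only: cinner_self of_real_add)
  then have "(norm (P x - Q x))\<^sup>2 + (norm (x - P x - Q x))\<^sup>2 = (norm x)\<^sup>2"
    using of_real_eq_iff by blast
  moreover have "0 \<le> (norm (x - P x - Q x))\<^sup>2" by simp
  ultimately have "(norm (P x - Q x))\<^sup>2 \<le> (norm x)\<^sup>2" by linarith
  then show ?thesis by (rule power2_le_imp_le) simp
qed

end

section \<open>Swapping two projections\<close>

locale canonical_projection_pair = projection_pair P Q for P Q :: "'h::chilbert_space \<Rightarrow> 'h" +
  fixes M :: "'k::chilbert_space \<times> 'k \<Rightarrow> 'h" and a :: "'k \<Rightarrow> 'k"
  assumes triple: "canonical_triple P Q M a"
begin

section \<open>The pair of projections in the coordinates of the triple\<close>

definition s :: "'k \<Rightarrow> 'k" where "s = operator_sqrt (\<lambda>y. y - a (a y))"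

definition D :: "'k \<times> 'k \<Rightarrow> 'k \<times> 'k" where "D k = (a (fst k), - a (snd k))"

definition E :: "'k \<times> 'k \<Rightarrow> 'k \<times> 'k" where "E k = (s (snd k), s (fst k))"

lemma M: "unitary_onto UNIV (generic_part P Q) M"
  using triple by (simp add: canonical_triple_def)

lemma pos_a: "positive_operator a"
  using triple by (simp add: canonical_triple_def)

lemma lin_a: "bounded_clinear a"
  using pos_a by (simp add: positive_operator_def)

lemmas linM = bounded_clinear_simps[OF bounded_clinear_unitary_onto[OF M]]
lemmas lina = bounded_clinear_simps[OF lin_a]

lemma M_in: "M k \<in> generic_part P Q"
  by (rule unitary_onto_in[OF M]) simp

lemma M_inj: "M k = M l \<Longrightarrow> k = l"
  by (metis cadjoint_unitary_onto[OF M])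

lemma P_diff_Q_M: "P (M k) - Q (M k) = M (D k)"
  using triple M_in[of k]
  by (simp add: canonical_triple_def block_operator_def cadjoint_unitary_onto[OF M] D_def
      split_beta)

lemma id_diff_P_Q_M: "M k - P (M k) - Q (M k) = M (E k)"
  using triple M_in[of k]
  by (simp add: canonical_triple_def block_operator_def cadjoint_unitary_onto[OF M] E_def
      split_beta flip: s_def)

text \<open>Solves \<open>A = P - Q\<close> and \<open>B = I - P - Q\<close> for the projections:
  \<open>P = (I + A - B) / 2\<close> and \<open>Q = (I - A - B) / 2\<close>. A linear map that
  anticommutes with \<open>D\<close> and commutes with \<open>E\<close> therefore exchanges the
  two.\<close>

lemma P_M: "P (M k) = M ((1/2) *\<^sub>R (k + D k - E k))"
  and Q_M: "Q (M k) = M ((1/2) *\<^sub>R (k - D k - E k))"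
proof -
  have "(1/2) *\<^sub>R (M k + M (D k) - M (E k)) = (1/2) *\<^sub>R (2 *\<^sub>R P (M k))"
    unfolding P_diff_Q_M[symmetric] id_diff_P_Q_M[symmetric] by (simp add: scaleR_2)
  then show "P (M k) = M ((1/2) *\<^sub>R (k + D k - E k))"
    unfolding linM by simp
  have "(1/2) *\<^sub>R (M k - M (D k) - M (E k)) = (1/2) *\<^sub>R (2 *\<^sub>R Q (M k))"
    unfolding P_diff_Q_M[symmetric] id_diff_P_Q_M[symmetric] by (simp add: scaleR_2)
  then show "Q (M k) = M ((1/2) *\<^sub>R (k - D k - E k))"
    unfolding linM by simp
qed

section \<open>The contraction \<open>a\<close> and the root \<open>s\<close>\<close>

lemma norm_a_le: "norm (a x) \<le> norm x"
proof -
  have "norm (M (D (x, 0))) \<le> norm (M (x, 0))"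
    unfolding P_diff_Q_M[symmetric] by (rule norm_diff_projections_le)
  then show ?thesis by (simp add: norm_unitary_onto[OF M] D_def lina norm_Pair)
qed

lemma norm_a_a_le: "norm (a (a x)) \<le> norm x"
  by (rule order.trans[OF norm_a_le norm_a_le])

lemmas sa_a = positive_operator_self_adjoint[OF pos_a]

text \<open>Expanding the square, the term \<open>- 2 * (norm (a x))\<^sup>2\<close> dominates
  \<open>(norm (a (a x)))\<^sup>2\<close>. This is the contraction condition for the root of
  \<open>a \<circ> a\<close>, as \<open>norm_a_a_le\<close> is for the root
  \<open>s\<close>.\<close>

lemma norm_diff_a_a_le: "norm (x - a (a x)) \<le> norm x"
proof -
  have "Re (cinner x (a (a x))) = (norm (a x))\<^sup>2"
    by (simp add: cinner_self flip: sa_a)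
  moreover have "(norm (a (a x)))\<^sup>2 \<le> (norm (a x))\<^sup>2"
    by (intro power_mono norm_a_le) simp
  moreover have "0 \<le> (norm (a x))\<^sup>2" by simp
  ultimately have "(norm (x - a (a x)))\<^sup>2 \<le> (norm x)\<^sup>2"
    unfolding norm_diff_power2 by linarith
  then show ?thesis by (rule power2_le_imp_le) simp
qed

lemma
  shows pos_s: "positive_operator s"
    and s_s: "s (s x) = x - a (a x)"
    and s_commute: "bounded_linear R \<Longrightarrow> (\<And>x. R (a x) = a (R x)) \<Longrightarrow> R (s x) = s (R x)"
proof -
  have T: "bounded_clinear (\<lambda>y. y - a (a y))"
    by (rule bounded_clinear_sub[OF bounded_clinear_id bounded_clinear_compose[OF lin_a lin_a]])
  have sa: "cinner (x - a (a x)) y = cinner x (y - a (a y))" for x y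
    by (simp add: cinner_simps sa_a)
  have nrm: "norm (x - (x - a (a x))) \<le> norm x" for x
    by (simp add: norm_a_a_le)
  show "positive_operator s"
    unfolding s_def by (rule positive_operator_sqrt[OF T sa nrm])
  show "s (s x) = x - a (a x)"
    using operator_sqrt_square[OF T sa nrm] unfolding s_def[symmetric] by (simp add: fun_eq_iff)
  show "R (s x) = s (R x)" if "bounded_linear R" "\<And>x. R (a x) = a (R x)"
    using operator_sqrt_commute[OF T sa nrm that(1)] that
    unfolding s_def[symmetric]
    by (simp add: fun_eq_iff linear_diff[OF bounded_linear.linear[OF that(1)]])
qed

lemma lins: "s (x - y) = s x - s y" "s 0 = 0"
  using pos_s by (simp_all add: positive_operator_def bounded_clinear_simps)

text \<open>From \<open>s x = 0\<close> follows \<open>(I + a) (I - a) x = 0\<close>. The factor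
  \<open>I + a\<close> is injective by positivity of \<open>a\<close>, so \<open>a x = x\<close>,
  and 1 is not an eigenvalue.\<close>

lemma s_eq_0: "x = 0" if "s x = 0"
proof -
  define y where "y = x - a x"
  have "a y + y = 0"
    using s_s[of x] that by (simp add: lins y_def lina)
  then have "Re (cinner (a y) y) + (norm y)\<^sup>2 = 0"
    by (metis cinner_add_left cinner_zero_left plus_complex.sel(1) zero_complex.sel(1)
        cinner_self Re_complex_of_real)
  moreover have "0 \<le> Re (cinner (a y) y)"
    using pos_a by (simp add: positive_operator_def complex_nonneg_Reals_iff)
  ultimately have "(norm y)\<^sup>2 = 0"
    using zero_le_power2[of "norm y"] by linarith
  then have "a x = 1 *\<^sub>C x"
    by (simp add: y_def)
  then show ?thesis
    using triple by (auto simp: canonical_triple_def eigenvalue_def)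
qed

lemma anticommute_eq_0:
  assumes R: "bounded_linear R" and anti: "\<And>x. R (a x) = - a (R x)"
  shows "R x = 0"
proof -
  have T: "bounded_clinear (a \<circ> a)"
    unfolding comp_def by (rule bounded_clinear_compose[OF lin_a lin_a])
  have sa: "cinner ((a \<circ> a) x) y = cinner x ((a \<circ> a) y)" for x y
    by (simp add: sa_a)
  have nrm: "norm (x - (a \<circ> a) x) \<le> norm x" for x
    by (simp add: norm_diff_a_a_le)
  \<comment> \<open>Uniqueness identifies the root of \<open>a \<circ> a\<close> with
    \<open>a\<close> itself, so commuting with the square means commuting with
    \<open>a\<close>.\<close>
  have "operator_sqrt (a \<circ> a) = a"
    by (rule operator_sqrt_eqI[OF T sa nrm pos_a refl])
  moreover have "R \<circ> (a \<circ> a) = (a \<circ> a) \<circ> R"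
    by (simp add: fun_eq_iff anti lina)
  ultimately have "R \<circ> a = a \<circ> R"
    using operator_sqrt_commute[OF T sa nrm R] by metis
  then have "a (R x) = - a (R x)"
    using anti[of x] by (simp add: fun_eq_iff)
  then have "a (R x) = a 0"
    by (simp add: lina eq_neg_iff_add_eq_0 flip: scaleR_2)
  then show ?thesis
    using triple by (simp add: canonical_triple_def inj_eq)
qed

section \<open>Block form on the generic part\<close>

lemma swap_block_form:
  assumes W: "unitary W" and WD: "\<And>k. W (D k) = - D (W k)" and WE: "\<And>k. W (E k) = E (W k)"
  shows "\<exists>v. unitary v \<and> v \<circ> a = a \<circ> v \<and> W = block_operator (\<lambda>_. 0) v v (\<lambda>_. 0)"
proof -
  have bW: "bounded_linear W"
    using bounded_clinear_unitary_onto[OF W] by (simp add: bounded_clinear_def)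
  note linW = bounded_clinear_simps[OF bounded_clinear_unitary_onto[OF W]]
  \<comment> \<open>The four matrix entries of \<open>W\<close>, column by column.\<close>
  have bl: "bounded_linear (\<lambda>x. fst (W (x, 0)))" "bounded_linear (\<lambda>x. snd (W (x, 0)))"
    "bounded_linear (\<lambda>x. fst (W (0, x)))" "bounded_linear (\<lambda>x. snd (W (0, x)))"
    by (intro bounded_linear_compose[OF bounded_linear_fst] bounded_linear_compose[OF bounded_linear_snd]
        bounded_linear_compose[OF bW] bounded_linear_Pair bounded_linear_ident bounded_linear_zero)+
  \<comment> \<open>The sign in \<open>WD\<close> stays in the first column and cancels against that
    of \<open>D\<close> in the second. The signs of the outer \<open>D\<close> then make the
    diagonal entries anticommute and the off-diagonal ones commute with \<open>a\<close>.\<close>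
  have Wa1: "W (a x, 0) = - D (W (x, 0))" for x
    using WD[of "(x, 0)"] by (simp add: D_def lina)
  have "- W (0, a x) = - D (W (0, x))" for x
    using WD[of "(0, x)"] linW(3)[of "(0, a x)"] by (simp add: D_def lina)
  then have Wa2: "W (0, a x) = D (W (0, x))" for x
    by (simp only: neg_equal_iff_equal)
  have "fst (W (x, 0)) = 0" for x
    by (rule anticommute_eq_0[OF bl(1)]) (simp add: Wa1 D_def)
  moreover have "snd (W (0, x)) = 0" for x
    by (rule anticommute_eq_0[OF bl(4)]) (simp add: Wa2 D_def)
  moreover define v u where "v x = fst (W (0, x))" and "u x = snd (W (x, 0))" for x
  ultimately have Wv: "W (0, x) = (v x, 0)" and Wu: "W (x, 0) = (0, u x)" for x
    by (simp_all add: prod_eq_iff)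
  have va: "v (a x) = a (v x)" for x
    by (simp add: v_def Wa2 D_def)
  have vs: "v (s x) = s (v x)" for x
    by (rule s_commute) (use bl(3) va in \<open>simp_all add: v_def\<close>)
  have vu: "v x = u x" for x
  proof -
    \<comment> \<open>As \<open>E\<close> sends \<open>(x, 0)\<close> to \<open>(0, s x)\<close>,
      commutation with \<open>E\<close> compares the two off-diagonal entries; \<open>vs\<close>
      then moves \<open>v\<close> past \<open>s\<close>.\<close>
    have "W (E (x, 0)) = (v (s x), 0)" "E (W (x, 0)) = (s (u x), 0)"
      by (simp_all add: E_def lins Wv Wu)
    then have "v (s x) = s (u x)"
      using WE[of "(x, 0)"] by simp
    then have "s (v x - u x) = 0"
      by (simp add: lins vs)
    then show ?thesis using s_eq_0 by force
  qed
  have Wxy: "W (x, y) = (v y, v x)" for x y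
    using linW(1)[of "(x, 0)" "(0, y)"] by (simp add: Wv Wu vu)
  have "unitary v"
    unfolding unitary_onto_def
  proof (intro conjI ballI allI)
    fix x y c
    show "v (x + y) = v x + v y"
      using linW(1)[of "(0, x)" "(0, y)"] by (simp add: Wv)
    show "v (c *\<^sub>C x) = c *\<^sub>C v x"
      using linW(6)[of c "(0, x)"] by (simp add: Wv scaleC_prod_def)
    show "cinner (v x) (v y) = cinner x y"
      using unitary_onto_cinner[OF W, of "(0, x)" "(0, y)"] by (simp add: Wv cinner_prod_def)
  next
    have "\<exists>x. y = v x" for y
      using unitary_onto_obtain[OF W, of "(y, 0)"] by (auto simp: Wxy)
    then show "range v = UNIV" by blast
  qed
  moreover have "v \<circ> a = a \<circ> v"
    using va by (simp add: fun_eq_iff)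
  moreover have "W = block_operator (\<lambda>_. 0) v v (\<lambda>_. 0)"
    by (simp add: fun_eq_iff block_operator_def Wxy)
  ultimately show ?thesis by blast
qed

text \<open>\<open>U\<close> itself serves as all four operators, since \<open>unitary_onto\<close>
  only looks at values on the given subspace. Only \<open>v\<close> has to be constructed, from
  \<open>U\<close> in the coordinates of \<open>M\<close>.\<close>

lemma swapping_unitary_is_swap_form:
  assumes U: "unitary U" and QU: "Q = U \<circ> P \<circ> cadjoint U" and PU: "P = U \<circ> Q \<circ> cadjoint U"
  shows "\<exists>v. unitary_onto (M00 P Q) (M00 P Q) U \<and> unitary_onto (M01 P Q) (M10 P Q) U \<and>
    unitary_onto (M10 P Q) (M01 P Q) U \<and> unitary_onto (M11 P Q) (M11 P Q) U \<and>
    unitary v \<and> v \<circ> a = a \<circ> v \<and> U = swap_form P Q M U U U U v"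
proof -
  note linU = bounded_clinear_simps[OF bounded_clinear_unitary_onto[OF U]]
  have Uinj: "U x = U y \<longleftrightarrow> x = y" for x y
    by (metis cadjoint_unitary_onto[OF U])
  have U0: "U x = 0 \<longleftrightarrow> x = 0" for x
    using Uinj[of x 0] by (simp add: linU)
  have comm: "Q (U x) = U (P x)" "P (U x) = U (Q x)" for x
    using fun_cong[OF QU, of "U x"] fun_cong[OF PU, of "U x"]
    by (simp_all add: cadjoint_unitary_onto[OF U])
  \<comment> \<open>\<open>U\<close> carries eigenvalue equations of \<open>P\<close> to those of
    \<open>Q\<close> and back, so spaces with equal eigenvalues are preserved and the mixed ones
    exchanged.\<close>
  have iffs: "U x \<in> M00 P Q \<longleftrightarrow> x \<in> M00 P Q" "U x \<in> M01 P Q \<longleftrightarrow> x \<in> M10 P Q"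
    "U x \<in> M10 P Q \<longleftrightarrow> x \<in> M01 P Q" "U x \<in> M11 P Q \<longleftrightarrow> x \<in> M11 P Q" for x
    by (auto simp: M_iffs comm Uinj U0)
  have surj: "\<exists>x. y = U x" for y
    using unitary_onto_obtain[OF U, of y] by auto
  have genU: "U x \<in> generic_part P Q \<longleftrightarrow> x \<in> generic_part P Q" for x
  proof -
    \<comment> \<open>By surjectivity the test vectors may be written as \<open>U y\<close>;
      \<open>U\<close> maps the union of the four subspaces onto itself.\<close>
    have "(\<forall>y. y \<in> M00 P Q \<union> M01 P Q \<union> M10 P Q \<union> M11 P Q \<longrightarrow> cinner (U x) y = 0) \<longleftrightarrow>
      (\<forall>y. U y \<in> M00 P Q \<union> M01 P Q \<union> M10 P Q \<union> M11 P Q \<longrightarrow> cinner (U x) (U y) = 0)"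
      using surj by metis
    then show ?thesis
      unfolding generic_part_iff Ball_def by (auto simp: iffs unitary_onto_cinner[OF U])
  qed
  \<comment> \<open>The equivalence also gives surjectivity: a preimage of a vector in
    \<open>T\<close> automatically lies in \<open>S\<close>.\<close>
  have restrict: "unitary_onto S T U" if "\<And>x. U x \<in> T \<longleftrightarrow> x \<in> S" for S T
    using that surj unfolding unitary_onto_def
    by (auto simp: linU unitary_onto_cinner[OF U]) (metis imageI)
  define W where "W k = cadjoint M (U (M k))" for k
  have MW: "M (W k) = U (M k)" for k
    unfolding W_def by (rule unitary_onto_cadjoint[OF M]) (simp add: genU M_in)
  have "unitary W"
    unfolding unitary_onto_def
  proof (intro conjI ballI allI)
    fix k l c
    show "W (k + l) = W k + W l" "W (c *\<^sub>C k) = c *\<^sub>C W k"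
      by (rule M_inj, simp add: MW linM linU)+
    have "cinner (M (W k)) (M (W l)) = cinner (M k) (M l)"
      unfolding MW by (simp add: unitary_onto_cinner[OF U])
    then show "cinner (W k) (W l) = cinner k l"
      by (simp add: unitary_onto_cinner[OF M])
  next
    have "\<exists>k. l = W k" for l
    proof -
      obtain x where x: "M l = U x" using surj by blast
      then have "x \<in> generic_part P Q" using genU M_in by metis
      then have "M l = M (W (cadjoint M x))"
        by (simp add: MW unitary_onto_cadjoint[OF M] x)
      then show ?thesis using M_inj by blast
    qed
    then show "range W = UNIV" by blast
  qed
  moreover have "W (D k) = - D (W k)" for k
    by (rule M_inj) (simp add: MW linM linU comm flip: P_diff_Q_M)
  moreover have "W (E k) = E (W k)" for k
    by (rule M_inj) (simp add: MW linU comm flip: id_diff_P_Q_M)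
  ultimately obtain v where v: "unitary v" "v \<circ> a = a \<circ> v"
    and Wv: "W = block_operator (\<lambda>_. 0) v v (\<lambda>_. 0)"
    using swap_block_form by blast
  have "U x = swap_form P Q M U U U U v x" for x
  proof -
    obtain x00 x01 x10 x11 xg
      where x: "parts x00 x01 x10 x11 xg" "x = x00 + x01 + x10 + x11 + xg"
      by (rule parts_obtain)
    have "U xg = M (W (cadjoint M xg))"
      using x(1) by (simp add: MW unitary_onto_cadjoint[OF M] parts_def)
    then show ?thesis
      unfolding swap_form_def x(2) orth_proj_parts[OF x(1)] Wv[symmetric]
      by (simp add: linU add_ac)
  qed
  then show ?thesis
    using v restrict iffs by blast
qed

text \<open>Everything acts summand by summand, so unitarity and both exchange relations are checked
  on components; on the generic part they reduce to relations with \<open>D\<close> and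
  \<open>E\<close>.\<close>

lemma swap_form_is_swapping_unitary:
  assumes U0: "unitary_onto (M00 P Q) (M00 P Q) U0" and U10: "unitary_onto (M01 P Q) (M10 P Q) U10"
    and U01: "unitary_onto (M10 P Q) (M01 P Q) U01" and U1: "unitary_onto (M11 P Q) (M11 P Q) U1"
    and v: "unitary v" and va: "v \<circ> a = a \<circ> v"
  defines "U \<equiv> swap_form P Q M U0 U10 U01 U1 v"
  shows "unitary U" and "Q = U \<circ> P \<circ> cadjoint U" and "P = U \<circ> Q \<circ> cadjoint U"
proof -
  define V where "V k = (v (snd k), v (fst k))" for k
  note linv = bounded_clinear_simps[OF bounded_clinear_unitary_onto[OF v]]
  have V: "unitary V"
    unfolding unitary_onto_def
  proof (intro conjI ballI allI)
    have "\<exists>k. l = V k" for l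
    proof -
      obtain x y where "fst l = v x" "snd l = v y"
        using unitary_onto_obtain[OF v] by (metis UNIV_I)
      then have "l = V (y, x)" by (simp add: V_def prod_eq_iff)
      then show ?thesis ..
    qed
    then show "range V = UNIV" by blast
  qed (simp_all add: V_def linv scaleC_prod_def cinner_prod_def unitary_onto_cinner[OF v])
  note linV = bounded_clinear_simps[OF bounded_clinear_unitary_onto[OF V]]
  have "v (a x) = a (v x)" for x
    using va by (simp add: fun_eq_iff)
  \<comment> \<open>\<open>V\<close> interchanges the coordinates, on which \<open>D\<close> has
    opposite signs while \<open>E\<close> is symmetric.\<close>
  then have VD: "V (D k) = - D (V k)" and VE: "V (E k) = E (V k)" for k
    using s_commute[of v] bounded_clinear_unitary_onto[OF v]
    by (simp_all add: V_def D_def E_def linv bounded_clinear_def)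
  define Ug where "Ug x = M (V (cadjoint M x))" for x
  have UgM: "Ug (M k) = M (V k)" for k
    by (simp add: Ug_def cadjoint_unitary_onto[OF M])
  have UgP: "Ug (P x) = Q (Ug x)" and UgQ: "Ug (Q x) = P (Ug x)" if x: "x \<in> generic_part P Q" for x
  proof -
    obtain k where k: "x = M k"
      using unitary_onto_obtain[OF M x] by blast
    show "Ug (P x) = Q (Ug x)" "Ug (Q x) = P (Ug x)"
      unfolding k UgM P_M Q_M linV VD VE by simp_all
  qed
  have Ug: "unitary_onto (generic_part P Q) (generic_part P Q) Ug"
    unfolding unitary_onto_def
  proof (intro conjI ballI allI)
    fix x y c assume "x \<in> generic_part P Q"
    then obtain k where x: "x = M k"
      using unitary_onto_obtain[OF M] by blast
    show "Ug (c *\<^sub>C x) = c *\<^sub>C Ug x"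
      unfolding x linM(6)[symmetric] UgM linV ..
    assume "y \<in> generic_part P Q"
    then obtain l where y: "y = M l"
      using unitary_onto_obtain[OF M] by blast
    show "Ug (x + y) = Ug x + Ug y"
      unfolding x y linM(1)[symmetric] UgM linV ..
    show "cinner (Ug x) (Ug y) = cinner x y"
      unfolding x y UgM by (simp add: unitary_onto_cinner[OF M] unitary_onto_cinner[OF V])
  next
    have "\<exists>x\<in>generic_part P Q. y = Ug x" if y: "y \<in> generic_part P Q" for y
    proof -
      obtain k where "y = M k" using unitary_onto_obtain[OF M y] by blast
      moreover obtain l where "k = V l" using unitary_onto_obtain[OF V] by blast
      ultimately show ?thesis using UgM M_in by metis
    qed
    moreover have "Ug x \<in> generic_part P Q" for x by (simp add: Ug_def M_in)
    ultimately show "Ug ` generic_part P Q = generic_part P Q" by blast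
  qed
  \<comment> \<open>The terms are ordered by target: \<open>U01 x10\<close> lies in
    \<open>M01\<close> and \<open>U10 x01\<close> in \<open>M10\<close>, so the image is again in
    the order of \<open>parts\<close>.\<close>
  have U_parts: "U (x00 + x01 + x10 + x11 + xg) = U0 x00 + U01 x10 + U10 x01 + U1 x11 + Ug xg"
    if x: "parts x00 x01 x10 x11 xg" for x00 x01 x10 x11 xg
    unfolding U_def swap_form_def orth_proj_parts[OF x]
    by (simp add: Ug_def V_def block_operator_def split_beta)
  have image: "parts (U0 x00) (U01 x10) (U10 x01) (U1 x11) (Ug xg)"
    if "parts x00 x01 x10 x11 xg" for x00 x01 x10 x11 xg
    using that unitary_onto_in[OF U0] unitary_onto_in[OF U01] unitary_onto_in[OF U10]
      unitary_onto_in[OF U1] unitary_onto_in[OF Ug] by (simp add: parts_def)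
  \<comment> \<open>The four operators are arbitrary off their subspaces; their value at 0 comes
    from unitarity there.\<close>
  note zeros = unitary_onto_zero[OF U0] unitary_onto_zero[OF U01] unitary_onto_zero[OF U10]
    unitary_onto_zero[OF U1] parts_zero
  show U: "unitary U"
    unfolding unitary_onto_def
  proof (intro conjI ballI allI)
    fix x y :: 'h and c
    obtain x00 x01 x10 x11 xg
      where x: "parts x00 x01 x10 x11 xg" and x_eq: "x = x00 + x01 + x10 + x11 + xg"
      by (rule parts_obtain)
    obtain y00 y01 y10 y11 yg
      where y: "parts y00 y01 y10 y11 yg" and y_eq: "y = y00 + y01 + y10 + y11 + yg"
      by (rule parts_obtain)
    note x' = x[unfolded parts_def] and y' = y[unfolded parts_def]
    have "parts (x00 + y00) (x01 + y01) (x10 + y10) (x11 + y11) (xg + yg)"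
      using x' y' subspace_parts[THEN complex_vector.subspace_add] by (simp add: parts_def)
    moreover have "x + y = (x00 + y00) + (x01 + y01) + (x10 + y10) + (x11 + y11) + (xg + yg)"
      by (simp add: x_eq y_eq algebra_simps)
    ultimately have "U (x + y) =
        U0 (x00 + y00) + U01 (x10 + y10) + U10 (x01 + y01) + U1 (x11 + y11) + Ug (xg + yg)"
      using U_parts by presburger
    then show "U (x + y) = U x + U y"
      unfolding x_eq y_eq U_parts[OF x] U_parts[OF y]
      using x' y' unitary_onto_add[OF U0] unitary_onto_add[OF U01] unitary_onto_add[OF U10]
        unitary_onto_add[OF U1] unitary_onto_add[OF Ug] by (simp add: algebra_simps)
    have "parts (c *\<^sub>C x00) (c *\<^sub>C x01) (c *\<^sub>C x10) (c *\<^sub>C x11) (c *\<^sub>C xg)"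
      using x' subspace_parts[THEN complex_vector.subspace_scale] by (simp add: parts_def)
    from U_parts[OF this] show "U (c *\<^sub>C x) = c *\<^sub>C U x"
      unfolding x_eq U_parts[OF x]
      using x' unitary_onto_scaleC[OF U0] unitary_onto_scaleC[OF U01] unitary_onto_scaleC[OF U10]
        unitary_onto_scaleC[OF U1] unitary_onto_scaleC[OF Ug] by (simp add: scaleC_add_right)
    show "cinner (U x) (U y) = cinner x y"
      unfolding x_eq y_eq U_parts[OF x] U_parts[OF y] cinner_parts[OF x y]
        cinner_parts[OF image[OF x] image[OF y]]
      using x' y' unitary_onto_cinner[OF U0] unitary_onto_cinner[OF U01] unitary_onto_cinner[OF U10]
        unitary_onto_cinner[OF U1] unitary_onto_cinner[OF Ug] by simp
  next
    have "\<exists>x. y = U x" for y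
    proof -
      obtain y00 y01 y10 y11 yg
        where y: "parts y00 y01 y10 y11 yg" and y_eq: "y = y00 + y01 + y10 + y11 + yg"
        by (rule parts_obtain)
      note y' = y[unfolded parts_def]
      obtain x00 x01 x10 x11 xg where "x00 \<in> M00 P Q" "y00 = U0 x00" "x10 \<in> M10 P Q" "y01 = U01 x10"
        "x01 \<in> M01 P Q" "y10 = U10 x01" "x11 \<in> M11 P Q" "y11 = U1 x11"
        "xg \<in> generic_part P Q" "yg = Ug xg"
        using y' unitary_onto_obtain[OF U0] unitary_onto_obtain[OF U01] unitary_onto_obtain[OF U10]
          unitary_onto_obtain[OF U1] unitary_onto_obtain[OF Ug] by metis
      then have "y = U (x00 + x01 + x10 + x11 + xg)"
        unfolding y_eq by (simp add: U_parts parts_def)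
      then show ?thesis ..
    qed
    then show "range U = UNIV" by blast
  qed
  have swap: "U (P x) = Q (U x) \<and> U (Q x) = P (U x)" for x
  proof -
    obtain x00 x01 x10 x11 xg
      where x: "parts x00 x01 x10 x11 xg" and x_eq: "x = x00 + x01 + x10 + x11 + xg"
      by (rule parts_obtain)
    note x' = x[unfolded parts_def M_iffs]
    \<comment> \<open>The zeros keep the five-term shape that \<open>U_parts\<close>
      expects.\<close>
    have Px: "P x = x00 + x01 + 0 + 0 + P xg" and Qx: "Q x = x00 + 0 + x10 + 0 + Q xg"
      using x' by (simp_all add: x_eq linP linQ)
    have pP: "parts x00 x01 0 0 (P xg)" and pQ: "parts x00 0 x10 0 (Q xg)"
      using x generic_part_invariant[of xg] by (simp_all add: parts_def parts_zero)
    note i' = image[OF x, unfolded parts_def M_iffs]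
    show ?thesis
      unfolding Px Qx U_parts[OF pP] U_parts[OF pQ] unfolding x_eq U_parts[OF x]
      using i' x' UgP UgQ by (simp add: linP linQ zeros)
  qed
  \<comment> \<open>Evaluating \<open>swap\<close> at \<open>cadjoint U x\<close> turns it into the
    two conjugation formulas.\<close>
  have "U (cadjoint U x) = x" for x
    by (rule unitary_onto_cadjoint[OF U]) simp
  then show "Q = U \<circ> P \<circ> cadjoint U" "P = U \<circ> Q \<circ> cadjoint U"
    using swap by (simp_all add: fun_eq_iff)
qed

end

theorem theorem5:
  fixes P Q :: "'h::chilbert_space \<Rightarrow> 'h"
    and M :: "'k::chilbert_space \<times> 'k \<Rightarrow> 'h"
    and a :: "'k \<Rightarrow> 'k"
  assumes "orthogonal_projection P" and "orthogonal_projection Q"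
    and "(hilbert_dim (M01 P Q), hilbert_dim (M10 P Q)) \<in> ordIso"
    and "canonical_triple P Q M a"
  shows "{U. unitary U \<and> Q = U \<circ> P \<circ> cadjoint U \<and> P = U \<circ> Q \<circ> cadjoint U} =
    {swap_form P Q M U0 U10 U01 U1 v | U0 U10 U01 U1 v.
       unitary_onto (M00 P Q) (M00 P Q) U0 \<and>
       unitary_onto (M01 P Q) (M10 P Q) U10 \<and>
       unitary_onto (M10 P Q) (M01 P Q) U01 \<and>
       unitary_onto (M11 P Q) (M11 P Q) U1 \<and>
       unitary v \<and> v \<circ> a = a \<circ> v}"
proof -
  interpret canonical_projection_pair P Q M a
    using assms by unfold_locales
  show ?thesis
  proof (intro equalityI subsetI)
    fix U assume "U \<in> {U. unitary U \<and> Q = U \<circ> P \<circ> cadjoint U \<and> P = U \<circ> Q \<circ> cadjoint U}"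
    then have "unitary U" "Q = U \<circ> P \<circ> cadjoint U" "P = U \<circ> Q \<circ> cadjoint U" by blast+
    from swapping_unitary_is_swap_form[OF this]
    show "U \<in> {swap_form P Q M U0 U10 U01 U1 v | U0 U10 U01 U1 v.
       unitary_onto (M00 P Q) (M00 P Q) U0 \<and> unitary_onto (M01 P Q) (M10 P Q) U10 \<and>
       unitary_onto (M10 P Q) (M01 P Q) U01 \<and> unitary_onto (M11 P Q) (M11 P Q) U1 \<and>
       unitary v \<and> v \<circ> a = a \<circ> v}"
      by blast
  next
    fix U assume "U \<in> {swap_form P Q M U0 U10 U01 U1 v | U0 U10 U01 U1 v.
       unitary_onto (M00 P Q) (M00 P Q) U0 \<and> unitary_onto (M01 P Q) (M10 P Q) U10 \<and>
       unitary_onto (M10 P Q) (M01 P Q) U01 \<and> unitary_onto (M11 P Q) (M11 P Q) U1 \<and>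
       unitary v \<and> v \<circ> a = a \<circ> v}"
    then obtain U0 U10 U01 U1 v where "U = swap_form P Q M U0 U10 U01 U1 v"
      "unitary_onto (M00 P Q) (M00 P Q) U0" "unitary_onto (M01 P Q) (M10 P Q) U10"
      "unitary_onto (M10 P Q) (M01 P Q) U01" "unitary_onto (M11 P Q) (M11 P Q) U1"
      "unitary v" "v \<circ> a = a \<circ> v"
      by blast
    then show "U \<in> {U. unitary U \<and> Q = U \<circ> P \<circ> cadjoint U \<and> P = U \<circ> Q \<circ> cadjoint U}"
      using swap_form_is_swapping_unitary by blast
  qed
qed

end
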